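(* Let $0<a\leq 1$, let $N$ be an odd positive integer and let $\alpha,\beta>0$ with $\alpha\beta^{N}=\pi^{N+1}$. Then for every positive integer $m$, \begin{align*} &\alpha^{-\frac{2Nm}{N+1}}\bigg(\left(a-\tfrac{1}{2}\right)\zeta(2Nm+1)+\sum_{j=1}^{m-1}\frac{B_{2j+1}(a)}{(2j+1)!}\zeta(2Nm+1-2jN)(2^N\alpha)^{2j}+\sum_{n=1}^{\infty}\frac{n^{-2Nm-1}\exp\left(-a(2n)^{N}\alpha\right)}{1-\exp\left(-(2n)^{N}\alpha\right)}\bigg)\\ &=\left(-\beta^{\frac{2N}{N+1}}\right)^{-m}\frac{2^{2m(N-1)}}{N}\bigg[\frac{(-1)^{m+1}(2\pi)^{2m}B_{2m+1}(a)N\gamma}{(2m+1)!}+\frac{1}{2}\sum_{n=1}^{\infty}\frac{\cos(2\pi na)}{n^{2m+1}}\\ &\quad+(-1)^{\frac{N+3}{2}}\sum_{j=-\frac{N-1}{2}}^{\frac{N-1}{2}}(-1)^{j}\bigg\{\sum_{n=1}^{\infty}\frac{n^{-2m-1}\cos(2\pi na)}{\exp\left((2n)^{\frac{1}{N}}\beta e^{\frac{i\pi j}{N}}\right)-1}\\ &\quad+\frac{(-1)^{j+\frac{N+3}{2}}}{2\pi}\sum_{n=1}^{\infty}\frac{\sin(2\pi na)}{n^{2m+1}}\left(\psi\left(\tfrac{i\beta}{2\pi}(2n)^{\frac{1}{N}}e^{\frac{i\pi j}{N}}\right)+\psi\left(\tfrac{-i\beta}{2\pi}(2n)^{\frac{1}{N}}e^{\frac{i\pi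 j}{N}}\right)\right)\bigg\}\bigg]\\ &\quad+(-1)^{m+\frac{N+3}{2}}2^{2Nm}\sum_{j=0}^{\left\lfloor\frac{N+1}{2N}+m\right\rfloor}\frac{(-1)^jB_{2j}(a)B_{N+1+2N(m-j)}}{(2j)!(N+1+2N(m-j))!}\alpha^{\frac{2j}{N+1}}\beta^{N+\frac{2N^2(m-j)}{N+1}}. \end{align*}
   Context: $\gamma$ is Euler's constant, $\zeta$ the Riemann zeta function, $B_j(a)$ Bernoulli polynomials ($\sum_{j\ge0}B_j(a)z^j/j!=ze^{az}/(e^z-1)$), $B_j=B_j(1)$ Bernoulli numbers, $\psi=\Gamma'/\Gamma$ the digamma function. Sums over $j$ run through integers; empty sums are $0$. *)

theory Defs
  imports "HOL-Analysis.Analysis" "HOL-Computational_Algebra.Formal_Power_Series"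
begin

definition bernpoly :: "nat \<Rightarrow> real \<Rightarrow> real" where
  "bernpoly j a = fact j * fps_nth (fps_X * fps_exp a / (fps_exp 1 - 1)) j"

definition bernoulli :: "nat \<Rightarrow> real" where
  "bernoulli j = bernpoly j 1"

text \<open>Riemann zeta function on the real half-line s > 1 (only used there),
  given by its Dirichlet series.\<close>
definition zeta :: "real \<Rightarrow> real" where
  "zeta s = (\<Sum>n. 1 / (real (Suc n)) powr s)"

end

theory Submission
  imports Defs
begin

text \<open>
  Put \<open>f(t) = exp (-a t) / (1 - exp (-t))\<close>. Since \<open>f\<close> as a function of \<open>a\<close> on \<open>[0,1]\<close> has the Fourier
  coefficients \<open>1 / (t + 2 \<pi> i k)\<close>, its Taylor remainder in \<open>t\<close> after the term \<open>B_{2m}(a)\<close> is an absolutely convergent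
  trigonometric series in \<open>a\<close> with coefficients rational in \<open>t\<close>. Substituting \<open>t = (2n)^N \<alpha>\<close> and summing against
  \<open>n^(-2Nm-1)\<close>, the Taylor terms give the odd zeta values (moved to the left-hand side) and the even zeta values (the last
  finite sum), while in the remainder the sums over \<open>n\<close> and over the Fourier index may be interchanged. The inner sum over
  \<open>n\<close> is that of a rational function with denominator \<open>n^(2N) + r^(2N)\<close>; partial fractions over the roots
  \<open>\<plusminus> i r exp (i \<pi> j / N)\<close> express it by cotangents, which yields the exponential terms, and by Digamma values.
  For \<open>N = 1\<close> the cotangent expansion leaves an extra \<open>1 / (2 r^2)\<close>, which is the term \<open>j = m + 1\<close> of the last sum.
\<close>

section \<open>Uniqueness of Fourier coefficients and absolutely convergent Fourier series\<close>

text \<open>The Taylor order \<open>2 * m\<close> is forced: the next term, with B_{2m+1}(a), would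
  meet the divergent sum of 1/n. In its place the remainder carries the sum of 1/n - n^(2N-1) /
  (n^(2N) + r^(2N)), which is Euler's constant plus an average of Digamma values over the roots; the
  constant, multiplied by the sine series of B_{2m+1}(a), becomes the gamma term of the formula.
  Subtracting the B_1 term also removes the jump of f between a = 0 and a = 1, because B_1 has the
  same jump. So the remainder has absolutely summable Fourier coefficients, and its series is valid
  up to the endpoint a = 1. For a function continuous on the closed interval with absolutely
  summable coefficients, the Fourier expansion reduces to uniqueness of coefficients, and this in
  turn to Weierstrass approximation by polynomials in the cosine. No contour integral
  occurs.\<close>

lemma has_integral_cis_int:
  "((\<lambda>x. cis (2 * pi * of_int k * x)) has_integral (if k = 0 then 1 else 0)) {0..1}"
proof (cases "k = 0")
  case True
  then show ?thesis using has_integral_const_real[of "1::complex" 0 1] by simp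
next
  case False
  let ?w = "2 * pi * of_int k :: real"
  have w: "?w \<noteq> 0" using False by simp
  have "((\<lambda>x. cis (?w * x)) has_integral (cis (?w * 1) / (\<i> * ?w) - cis (?w * 0) / (\<i> * ?w))) {0..1}"
  proof (rule fundamental_theorem_of_calculus)
    fix x :: real
    have "((\<lambda>x. exp (\<i> * (of_real ?w * of_real x)) / (\<i> * ?w)) has_vector_derivative
        exp (\<i> * (of_real ?w * of_real x))) (at x within {0..1})"
      by (rule has_vector_derivative_real_field)
        (use w in \<open>auto intro!: derivative_eq_intros simp: field_simps\<close>)
    then show "((\<lambda>x. cis (?w * x) / (\<i> * ?w)) has_vector_derivative cis (?w * x)) (at x within {0..1})"
      by (simp add: cis_conv_exp)
  qed simp
  moreover have "cis (?w * 1) = 1"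
    using cis_multiple_2pi[of "of_int k"] by (simp add: mult_ac)
  ultimately show ?thesis using False by simp
qed

text \<open>Powers of \<open>cos (2 * pi * x)\<close> are combinations of cosines of integer
  frequency, so orthogonality to all of these passes to every polynomial in
  \<open>cos (2 * pi * x)\<close>.\<close>

lemma integral_cos_power_zero:
  fixes h :: "real \<Rightarrow> real"
  assumes h: "continuous_on {0..1} h"
    and "\<And>k::int. integral {0..1} (\<lambda>x. h x * cos (2 * pi * of_int k * x)) = 0"
  shows "integral {0..1} (\<lambda>x. h x * cos (2 * pi * x) ^ n) = 0"
proof -
  \<comment> \<open>The extra cosine factor closes the induction: one more power moves the frequency
    \<open>k\<close> to \<open>k + 1\<close> and \<open>k - 1\<close>. The claim is the case
    \<open>k = 0\<close>.\<close>
  have "integral {0..1} (\<lambda>x. h x * cos (2 * pi * x) ^ n * cos (2 * pi * of_int k * x)) = 0" for k :: int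
  proof (induction n arbitrary: k)
    case 0
    then show ?case using assms by simp
  next
    case (Suc n)
    let ?F = "\<lambda>k::int. \<lambda>x. h x * cos (2 * pi * x) ^ n * cos (2 * pi * of_int k * x)"
    have int: "?F k integrable_on {0..1}" for k
      by (intro integrable_continuous_interval continuous_intros h)
    have "h x * cos (2 * pi * x) ^ Suc n * cos (2 * pi * of_int k * x)
        = (?F (k + 1) x + ?F (k - 1) x) * (1/2)" for x
    proof -
      have "cos (2*pi*x) * cos (2 * pi * of_int k * x)
          = (cos (2 * pi * of_int (k+1) * x) + cos (2 * pi * of_int (k-1) * x)) * (1/2)"
        using cos_times_cos[of "2*pi*x" "2 * pi * of_int k * x"] cos_minus[of "2 * pi * of_int (k-1) * x"]
        by (simp add: algebra_simps)
      then have "(h x * cos (2 * pi * x) ^ n) * (cos (2*pi*x) * cos (2 * pi * of_int k * x))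
          = (h x * cos (2 * pi * x) ^ n) * ((cos (2 * pi * of_int (k+1) * x) + cos (2 * pi * of_int (k-1) * x)) * (1/2))"
        by (rule arg_cong)
      then show ?thesis by (simp only: power_Suc distrib_left mult_ac)
    qed
    then have "integral {0..1} (\<lambda>x. h x * cos (2 * pi * x) ^ Suc n * cos (2 * pi * of_int k * x))
       = (integral {0..1} (?F (k+1)) + integral {0..1} (?F (k-1))) * (1/2)"
      by (simp only: integral_mult_left integral_add[OF int int])
    then show ?case by (simp only: Suc.IH) simp
  qed
  from this[of 0] show ?thesis by simp
qed

text \<open>Symmetry about 1/2 makes \<open>h\<close> a continuous function of
  \<open>u = cos (2 * pi * x)\<close>, so polynomial approximation on [-1,1] applies. As
  \<open>h\<close> is orthogonal to every approximating polynomial, its square integral is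
  arbitrarily small.\<close>

lemma symmetric_zero_cos_coeffs:
  fixes h :: "real \<Rightarrow> real"
  assumes h: "continuous_on {0..1} h"
    and sym: "\<And>x. x \<in> {0..1} \<Longrightarrow> h (1 - x) = h x"
    and coeff: "\<And>k::int. integral {0..1} (\<lambda>x. h x * cos (2 * pi * of_int k * x)) = 0"
    and x: "x \<in> {0..1}"
  shows "h x = 0"
proof -
  \<comment> \<open>\<open>arccos\<close> recovers \<open>x\<close> only on the left half of the
    interval; the right half is reached through \<open>1 - x\<close>.\<close>
  define H where "H u = h (arccos u / (2 * pi))" for u
  have H: "H (cos (2 * pi * x)) = h x" if x: "x \<in> {0..1}" for x
  proof (cases "x \<le> 1/2")
    case True
    then have "arccos (cos (2 * pi * x)) = 2 * pi * x"
      using x by (intro arccos_cos) auto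
    then show ?thesis by (simp add: H_def)
  next
    case False
    have "cos (2 * pi * (1 - x)) = cos (2 * pi * x)"
      using cos_2pi_minus[of "2 * pi * x"] by (simp add: algebra_simps)
    moreover have "arccos (cos (2 * pi * (1 - x))) = 2 * pi * (1 - x)"
    proof (rule arccos_cos)
      have "2 * pi * (1 - x) \<le> 2 * pi * (1/2)"
        using False by (intro mult_left_mono) auto
      then show "2 * pi * (1 - x) \<le> pi" by simp
    qed (use x in auto)
    ultimately have "arccos (cos (2 * pi * x)) = 2 * pi * (1 - x)" by simp
    then show ?thesis using sym[OF x] by (simp add: H_def)
  qed
  have contH: "continuous_on {-1..1} H"
    unfolding H_def
  proof (rule continuous_on_compose2[OF h])
    show "continuous_on {- 1..1} (\<lambda>u. arccos u / (2 * pi))"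
      by (intro continuous_intros) auto
    show "(\<lambda>u. arccos u / (2 * pi)) ` {- 1..1} \<subseteq> {0..1}"
      using arccos_bounded by (fastforce simp: field_simps arccos_lbound intro: order_trans[OF arccos_ubound])
  qed
  obtain B where B: "\<And>x. x \<in> {0..1} \<Longrightarrow> \<bar>h x\<bar> \<le> B" "B > 0"
  proof -
    have "bounded (h ` {0..1})"
      using compact_continuous_image[OF h] compact_imp_bounded by blast
    then obtain B where "B > 0" "\<forall>y \<in> h ` {0..1}. norm y \<le> B"
      using bounded_pos by metis
    then show ?thesis using that[of B] by auto
  qed
  have le: "integral {0..1} (\<lambda>x. h x * h x) \<le> e * B" if e: "e > 0" for e
  proof -
    obtain g where g: "real_polynomial_function g" "\<And>u. u \<in> {-1..1} \<Longrightarrow> \<bar>H u - g u\<bar> < e"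
      using Stone_Weierstrass_real_polynomial_function[OF compact_Icc contH e] by blast
    obtain a n where gs: "g = (\<lambda>x. \<Sum>i\<le>n. a i * x ^ i)"
      using g(1) real_polynomial_function_iff_sum by metis
    have gc: "continuous_on {0..1} (\<lambda>x. g (cos (2 * pi * x)))"
      unfolding gs by (intro continuous_intros)
    have "integral {0..1} (\<lambda>x. h x * g (cos (2 * pi * x)))
       = integral {0..1} (\<lambda>x. \<Sum>i\<le>n. a i * (h x * cos (2 * pi * x) ^ i))"
      unfolding gs by (simp add: sum_distrib_left mult_ac)
    also have "\<dots> = (\<Sum>i\<le>n. integral {0..1} (\<lambda>x. a i * (h x * cos (2 * pi * x) ^ i)))"
      by (intro integral_sum integrable_continuous_interval continuous_intros h) auto
    also have "\<dots> = 0"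
      using integral_cos_power_zero[OF h coeff] by simp
    finally have 0: "integral {0..1} (\<lambda>x. h x * g (cos (2 * pi * x))) = 0" .
    have "integral {0..1} (\<lambda>x. h x * h x)
       = integral {0..1} (\<lambda>x. h x * h x) - integral {0..1} (\<lambda>x. h x * g (cos (2 * pi * x)))"
      using 0 by simp
    also have "\<dots> = integral {0..1} (\<lambda>x. h x * h x - h x * g (cos (2 * pi * x)))"
      by (intro integral_diff[symmetric] integrable_continuous_interval continuous_intros h gc)
    also have "\<dots> \<le> integral {0..1} (\<lambda>x::real. e * B)"
    proof (intro integral_le integrable_continuous_interval continuous_intros h gc)
      fix x :: real assume x: "x \<in> {0..1}"
      have "h x * h x - h x * g (cos (2 * pi * x)) \<le> \<bar>h x * (H (cos (2*pi*x)) - g (cos (2 * pi * x)))\<bar>"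
        using H[OF x] by (simp add: algebra_simps)
      also have "\<dots> \<le> B * e"
        unfolding abs_mult using B(1)[OF x] g(2)[of "cos (2*pi*x)"] B(2)
        by (intro mult_mono) auto
      finally show "h x * h x - h x * g (cos (2 * pi * x)) \<le> e * B" by (simp add: mult.commute)
    qed
    finally show ?thesis by simp
  qed
  have "integral {0..1} (\<lambda>x. h x * h x) \<le> 0"
  proof (rule field_le_epsilon)
    fix e :: real assume "e > 0"
    then show "integral {0..1} (\<lambda>x. h x * h x) \<le> 0 + e"
      using le[of "e / B"] B(2) by simp
  qed
  moreover have "integral {0..1} (\<lambda>x. h x * h x) \<ge> 0"
    by (intro integral_nonneg integrable_continuous_interval continuous_intros h) auto
  ultimately have "integral {0..1} (\<lambda>x. h x * h x) = 0" by simp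
  then have "\<forall>x\<in>{0..1}. h x * h x = 0"
    by (subst (asm) integral_eq_0_iff) (auto intro!: continuous_intros h)
  then show ?thesis using x by simp
qed

lemma integral_flip_unit:
  fixes f :: "real \<Rightarrow> real"
  assumes "continuous_on {0..1} f"
  shows "integral {0..1} (\<lambda>x. f (1 - x)) = integral {0..1} f"
proof -
  have "(f has_integral integral {0..1} f) (cbox 0 1)"
    using assms by (simp add: integrable_continuous_interval integrable_integral)
  from has_integral_affinity[OF this, of "-1" 1]
  have "((\<lambda>x. f (1 - x)) has_integral integral {0..1} f) ((\<lambda>x. 1 - x) ` {0..1})"
    by simp
  moreover have "(\<lambda>x::real. 1 - x) ` {0..1} = {0..1}"
    by (auto intro!: image_eqI[of _ _ "1 - _"])
  ultimately show ?thesis by (simp add: integral_unique)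
qed

text \<open>The part of \<open>h\<close> symmetric about 1/2 falls under the previous lemma; the
  antisymmetric part does so after multiplication by \<open>sin (2 * pi * x)\<close>.\<close>

lemma zero_Fourier_coeffs:
  fixes h :: "real \<Rightarrow> real"
  assumes h: "continuous_on {0..1} h"
    and c: "\<And>k::int. integral {0..1} (\<lambda>x. h x * cos (2 * pi * of_int k * x)) = 0"
    and s: "\<And>k::int. integral {0..1} (\<lambda>x. h x * sin (2 * pi * of_int k * x)) = 0"
    and x: "x \<in> {0..1}"
  shows "h x = 0"
proof -
  have h': "continuous_on {0..1} (\<lambda>x. h (1 - x))"
    by (rule continuous_on_compose2[OF h]) (auto intro!: continuous_intros)
  have cosf: "cos (2 * pi * of_int k * (1 - x)) = cos (2 * pi * of_int k * x)" for k :: int and x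
    using cos_int_2pin[of k] sin_int_2pin[of k] by (simp add: algebra_simps cos_diff)
  have sinf: "sin (2 * pi * of_int k * (1 - x)) = - sin (2 * pi * of_int k * x)" for k :: int and x
    using cos_int_2pin[of k] sin_int_2pin[of k] by (simp add: algebra_simps sin_diff)
  have c': "integral {0..1} (\<lambda>x. h (1 - x) * cos (2 * pi * of_int k * x)) = 0" for k :: int
    using integral_flip_unit[of "\<lambda>x. h x * cos (2 * pi * of_int k * x)"] c[of k]
    by (simp add: cosf continuous_intros h)
  have s': "integral {0..1} (\<lambda>x. h (1 - x) * sin (2 * pi * of_int k * x)) = 0" for k :: int
    using integral_flip_unit[of "\<lambda>x. h x * sin (2 * pi * of_int k * x)"] s[of k]
    by (simp add: sinf continuous_intros h)
  have even: "h x + h (1 - x) = 0" if "x \<in> {0..1}" for x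
  proof (rule symmetric_zero_cos_coeffs[where h = "\<lambda>x. h x + h (1 - x)", OF _ _ _ that])
    fix k :: int
    have "integral {0..1} (\<lambda>x. (h x + h (1 - x)) * cos (2 * pi * real_of_int k * x))
      = integral {0..1} (\<lambda>x. h x * cos (2 * pi * real_of_int k * x))
        + integral {0..1} (\<lambda>x. h (1 - x) * cos (2 * pi * real_of_int k * x))"
      unfolding distrib_right
      by (intro integral_add integrable_continuous_interval continuous_intros h h')
    then show "integral {0..1} (\<lambda>x. (h x + h (1 - x)) * cos (2 * pi * real_of_int k * x)) = 0"
      using c c' by simp
  qed (auto intro!: continuous_intros h h')
  let ?d = "\<lambda>x. h x - h (1 - x)"
  have odd: "?d x * sin (2 * pi * x) = 0" if "x \<in> {0..1}" for x
  proof (rule symmetric_zero_cos_coeffs[where h = "\<lambda>x. ?d x * sin (2 * pi * x)", OF _ _ _ that])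
    fix x :: real
    show "?d (1 - x) * sin (2 * pi * (1 - x)) = ?d x * sin (2 * pi * x)"
      using sinf[of 1 x] by (simp add: algebra_simps)
  next
    fix k :: int
    let ?S = "\<lambda>h k x. h x * sin (2 * pi * real_of_int k * x) :: real"
    \<comment> \<open>The product formula turns a cosine coefficient of the product into differences
      of sine coefficients at \<open>k + 1\<close> and \<open>k - 1\<close>, all of which
      vanish.\<close>
    have "?d x * sin (2 * pi * x) * cos (2 * pi * real_of_int k * x)
        = (1/2) * ((?S h (k+1) x - ?S h (k-1) x) - (?S (\<lambda>x. h (1 - x)) (k+1) x - ?S (\<lambda>x. h (1 - x)) (k-1) x))" for x
    proof -
      have "sin (2 * pi * x) * cos (2 * pi * real_of_int k * x)
        = (1/2) * (sin (2 * pi * real_of_int (k+1) * x) - sin (2 * pi * real_of_int (k-1) * x))"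
        using sin_times_cos[of "2*pi*x" "2 * pi * real_of_int k * x"]
          sin_minus[of "2 * pi * real_of_int (k-1) * x"] by (simp add: algebra_simps)
      then have "?d x * (sin (2 * pi * x) * cos (2 * pi * real_of_int k * x))
        = ?d x * ((1/2) * (sin (2 * pi * real_of_int (k+1) * x) - sin (2 * pi * real_of_int (k-1) * x)))"
        by (rule arg_cong)
      then show ?thesis unfolding mult.assoc[symmetric] by (simp add: left_diff_distrib right_diff_distrib diff_divide_distrib)
    qed
    then have "integral {0..1} (\<lambda>x. ?d x * sin (2 * pi * x) * cos (2 * pi * real_of_int k * x))
      = (1/2) * ((integral {0..1} (?S h (k+1)) - integral {0..1} (?S h (k-1)))
        - (integral {0..1} (?S (\<lambda>x. h (1 - x)) (k+1)) - integral {0..1} (?S (\<lambda>x. h (1 - x)) (k-1))))"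
      by (simp only: integral_mult_right integral_diff integrable_continuous_interval integrable_diff
          continuous_intros h h' continuous_on_mult continuous_on_sin)
    then show "integral {0..1} (\<lambda>x. ?d x * sin (2 * pi * x) * cos (2 * pi * real_of_int k * x)) = 0"
      by (simp only: s s') simp
  qed (auto intro!: continuous_intros h h')
  \<comment> \<open>The sine has only the zeros 0, 1/2 and 1 in the interval, a negligible set;
    continuity of \<open>?d\<close> then covers these points as well.\<close>
  have "integral {0..1} (\<lambda>x. ?d x * ?d x) = integral {0..1} (\<lambda>x::real. 0::real)"
  proof (rule integral_spike[of "{0, 1/2, 1}"])
    fix x :: real assume x: "x \<in> {0..1} - {0, 1/2, 1}"
    have "sin (2 * pi * x) \<noteq> 0"
    proof
      assume "sin (2 * pi * x) = 0"
      then obtain i :: int where i: "2 * pi * x = of_int i * pi"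
        using sin_zero_iff_int2 by auto
      then have "2 * x = of_int i" by simp
      then show False using x by (cases "i \<le> 0"; cases "i = 1"; auto simp: le_less)
    qed
    then show "0 = ?d x * ?d x" using odd[of x] x by auto
  qed auto
  then have "integral {0..1} (\<lambda>x. ?d x * ?d x) = 0"
    by (simp only: integral_0)
  moreover have "integral {0..1} (\<lambda>x. ?d x * ?d x) = 0 \<longleftrightarrow> (\<forall>x\<in>{0..1}. ?d x * ?d x = 0)"
    by (rule integral_eq_0_iff) (intro continuous_intros h h', simp_all)
  ultimately have "?d x * ?d x = 0"
    using x by blast
  then show ?thesis using even[OF x] by simp
qed

text \<open>The series converges uniformly to a continuous \<open>G\<close> with the coefficients of
  \<open>h\<close>, so uniqueness applies to \<open>h - G\<close>. Since \<open>h\<close> is real,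
  opposite frequencies have conjugate coefficients, which folds the two-sided series into
  \<open>2 * Re\<close>; \<open>h0\<close> is the coefficient of frequency 0.\<close>

lemma Fourier_series_sums:
  fixes h :: "real \<Rightarrow> real" and c :: "nat \<Rightarrow> complex"
  assumes h: "continuous_on {0..1} h"
    and h0: "(h has_integral 0) {0..1}"
    and hc: "\<And>k. ((\<lambda>x. of_real (h x) * cis (- (2 * pi * real (Suc k) * x))) has_integral c k) {0..1}"
    and c: "summable (\<lambda>k. norm (c k))"
    and x: "x \<in> {0..1}"
  shows "(\<lambda>k. 2 * Re (c k * cis (2 * pi * real (Suc k) * x))) sums h x"
proof -
  define T where "T k x = 2 * Re (c k * cis (2 * pi * real (Suc k) * x))" for k x
  define G where "G x = (\<Sum>k. T k x)" for x
  have T_bound: "norm (T k x) \<le> 2 * norm (c k)" for k x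
    using abs_Re_le_cmod[of "c k * cis (2 * pi * real (Suc k) * x)"] by (simp add: T_def norm_mult abs_mult)
  have sumT: "summable (\<lambda>k. T k x)" for x
    by (rule summable_comparison_test[OF _ summable_mult[OF c, of 2]]) (use T_bound in auto)
  have uni: "uniform_limit {0..1} (\<lambda>n x. \<Sum>k<n. T k x) G sequentially"
    unfolding G_def by (rule Weierstrass_m_test[where M = "\<lambda>k. 2 * norm (c k)"])
      (use T_bound summable_mult[OF c, of 2] in auto)
  have contT: "continuous_on {0..1} (T k)" for k
    unfolding T_def by (intro continuous_intros)
  have contG: "continuous_on {0..1} G"
    by (rule uniform_limit_theorem[OF _ uni]) (auto intro!: always_eventually continuous_intros contT)
  \<comment> \<open>The two-sided coefficient family. Index \<open>k\<close> of \<open>c\<close>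
    belongs to frequency \<open>k + 1\<close>, hence the subtraction of 1.\<close>
  define I where "I n = (if n = 0 then 0 else if n > 0 then c (nat n - 1) else cnj (c (nat (-n) - 1)))" for n :: int
  have T_int: "((\<lambda>x. of_real (T k x) * cis (- (2 * pi * of_int n * x))) has_integral
      (if n = int (Suc k) then c k else if n = - int (Suc k) then cnj (c k) else 0)) {0..1}" for k n
  proof -
    have "of_real (T k x) * cis (- (2 * pi * of_int n * x))
        = c k * cis (2 * pi * of_int (int (Suc k) - n) * x) + cnj (c k) * cis (2 * pi * of_int (- int (Suc k) - n) * x)" for x
    proof -
      have "of_real (T k x) = c k * cis (2 * pi * real (Suc k) * x) + cnj (c k) * cis (- (2 * pi * real (Suc k) * x))"
        unfolding T_def complex_add_cnj[symmetric] by (simp add: cis_cnj complex_cnj_mult)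
      then show ?thesis
        by (simp add: distrib_right mult.assoc cis_mult algebra_simps)
    qed
    moreover have "((\<lambda>x. c k * cis (2 * pi * of_int (int (Suc k) - n) * x) + cnj (c k) * cis (2 * pi * of_int (- int (Suc k) - n) * x))
      has_integral (c k * (if int (Suc k) - n = 0 then 1 else 0) + cnj (c k) * (if - int (Suc k) - n = 0 then 1 else 0))) {0..1}"
      by (intro has_integral_add has_integral_mult_right has_integral_cis_int)
    ultimately show ?thesis by (auto split: if_splits)
  qed
  have G_int: "((\<lambda>x. of_real (G x) * cis (- (2 * pi * of_int n * x))) has_integral I n) {0..1}" for n
  proof -
    let ?e = "\<lambda>x. cis (- (2 * pi * of_int n * x))"
    have lim: "uniform_limit {0..1} (\<lambda>N x. of_real (\<Sum>k<N. T k x) * ?e x) (\<lambda>x. of_real (G x) * ?e x) sequentially"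
    proof (rule uniform_limitI)
      fix \<epsilon> :: real assume "\<epsilon> > 0"
      then have "\<forall>\<^sub>F N in sequentially. \<forall>x\<in>{0..1}. dist (\<Sum>k<N. T k x) (G x) < \<epsilon>"
        using uni uniform_limitD by blast
      then show "\<forall>\<^sub>F N in sequentially. \<forall>x\<in>{0..1}. dist (of_real (\<Sum>k<N. T k x) * ?e x) (of_real (G x) * ?e x) < \<epsilon>"
      proof eventually_elim
        case (elim N)
        show ?case
        proof
          fix x :: real assume "x \<in> {0..1}"
          have "dist (of_real (\<Sum>k<N. T k x) * ?e x) (of_real (G x) * ?e x) = dist (\<Sum>k<N. T k x) (G x)"
            unfolding dist_norm left_diff_distrib[symmetric] of_real_diff[symmetric] norm_mult norm_of_real by simp
          then show "dist (of_real (\<Sum>k<N. T k x) * ?e x) (of_real (G x) * ?e x) < \<epsilon>"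
            using elim \<open>x \<in> {0..1}\<close> by simp
        qed
      qed
    qed
    have conte: "continuous_on {0..1} ?e"
      by (intro continuous_intros)
    obtain IN J where IJ: "\<And>N. ((\<lambda>x. of_real (\<Sum>k<N. T k x) * ?e x) has_integral IN N) {0..1}"
        "((\<lambda>x. of_real (G x) * ?e x) has_integral J) {0..1}" "IN \<longlonglongrightarrow> J"
      by (rule uniform_limit_integral[OF lim]) (auto intro!: continuous_intros contT conte)
    \<comment> \<open>Frequency \<open>n\<close> sits at index \<open>nat \<bar>n\<bar> - 1\<close>,
      so from there on the coefficient of the partial sums is constant.\<close>
    have INval: "IN N = I n" if "N \<ge> nat \<bar>n\<bar>" for N
    proof -
      have "((\<lambda>x. \<Sum>k<N. of_real (T k x) * ?e x) has_integral
         (\<Sum>k<N. if n = int (Suc k) then c k else if n = - int (Suc k) then cnj (c k) else 0)) {0..1}"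
        by (intro has_integral_sum T_int) auto
      then have "IN N = (\<Sum>k<N. if n = int (Suc k) then c k else if n = - int (Suc k) then cnj (c k) else 0)"
        using has_integral_unique[OF IJ(1)[of N]] by (simp add: sum_distrib_right)
      also have "\<dots> = (\<Sum>k<N. if k = nat \<bar>n\<bar> - 1 then I n else 0)"
        by (intro sum.cong) (auto simp: I_def)
      also have "\<dots> = I n"
        using that by (auto simp: I_def)
      finally show ?thesis .
    qed
    have "IN \<longlonglongrightarrow> I n"
      by (rule tendsto_eventually, rule eventually_sequentiallyI[of "nat \<bar>n\<bar>"]) (rule INval)
    with IJ(2,3) show ?thesis
      using LIMSEQ_unique by blast
  qed
  have h_int: "((\<lambda>x. of_real (h x) * cis (- (2 * pi * of_int n * x))) has_integral I n) {0..1}" for n :: int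
  proof -
    consider "n = 0" | k where "n = int (Suc k)" | k where "n = - int (Suc k)"
    proof -
      have "n = 0 \<or> n = int (Suc (nat n - 1)) \<or> n = - int (Suc (nat (- n) - 1))" by auto
      then show ?thesis using that by blast
    qed
    then show ?thesis
    proof cases
      case 1
      have "((\<lambda>x. complex_of_real (h x)) has_integral 0) {0..1}"
        using has_integral_linear[OF h0 bounded_linear_of_real] by (simp add: o_def)
      then show ?thesis using 1 by (simp add: I_def)
    next
      case 2
      then have "I n = c k" by (simp add: I_def nat_add_distrib)
      then show ?thesis using hc[of k] 2 by simp
    next
      case 3
      have "((\<lambda>x. of_real (h x) * cis (2 * pi * real (Suc k) * x)) has_integral cnj (c k)) {0..1}"
        using has_integral_linear[OF hc[of k] bounded_linear_cnj] by (simp add: o_def cis_cnj)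
      moreover have "I n = cnj (c k)" using 3 by (simp add: I_def nat_add_distrib)
      moreover have "- (2 * pi * of_int n * x) = 2 * pi * real (Suc k) * x" for x
        unfolding 3 by (simp only: of_int_minus of_int_of_nat_eq mult_minus_left mult_minus_right minus_minus)
      ultimately show ?thesis by (simp only:)
    qed
  qed
  have d_int: "((\<lambda>x. of_real (h x - G x) * cis (- (2 * pi * of_int n * x))) has_integral 0) {0..1}" for n :: int
    using has_integral_diff[OF h_int[of n] G_int[of n]] by (simp add: algebra_simps)
  have "h x - G x = 0"
  proof (rule zero_Fourier_coeffs[OF _ _ _ x])
    fix k :: int
    have "((\<lambda>x. (h x - G x) * cos (2 * pi * of_int k * x)) has_integral Re 0) {0..1}"
      using has_integral_linear[OF d_int[of k] bounded_linear_Re] by (simp add: o_def)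
    then show "integral {0..1} (\<lambda>x. (h x - G x) * cos (2 * pi * of_int k * x)) = 0"
      by (simp add: integral_unique)
    have "((\<lambda>x. - ((h x - G x) * sin (2 * pi * of_int k * x))) has_integral Im 0) {0..1}"
      using has_integral_linear[OF d_int[of k] bounded_linear_Im] by (simp add: o_def)
    then show "integral {0..1} (\<lambda>x. (h x - G x) * sin (2 * pi * of_int k * x)) = 0"
      by (simp add: integral_unique has_integral_neg_iff)
  qed (intro continuous_intros h contG)
  then show ?thesis
    using summable_sums[OF sumT[of x]] by (simp add: G_def T_def)
qed

section \<open>Fourier series of Bernoulli polynomials\<close>

text \<open>\<open>fps_exp 1 - 1\<close> is not a unit; the quotient is exact because its subdegree
  does not exceed that of \<open>fps_X\<close>.\<close>

lemma bernpoly_generating_fps: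
  "fps_X * fps_exp a / (fps_exp 1 - 1) = (fps_X / (fps_exp 1 - 1)) * fps_exp (a::real)"
  (is ?A)
  "(fps_X / (fps_exp 1 - 1)) * (fps_exp 1 - 1) = (fps_X :: real fps)" (is ?B)
proof -
  have 1: "fps_nth (fps_exp 1 - 1 :: real fps) (Suc 0) \<noteq> 0" by simp
  then have sd: "subdegree (fps_exp 1 - 1 :: real fps) \<le> subdegree (fps_X :: real fps)"
    by (intro subdegree_leI) simp
  show ?A by (rule fps_divide_times2[OF sd])
  have "(fps_exp 1 - 1 :: real fps) \<noteq> 0" using 1 by auto
  then show ?B
    using fps_divide_times2[OF sd, of "fps_exp 1 - 1"] by (simp add: fps_divide_times_eq)
qed

text \<open>With the factorial divided out, differentiation is a pure index shift and the Fourier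
  coefficients are pure powers.\<close>

definition bern_norm :: "nat \<Rightarrow> real \<Rightarrow> real" where
  "bern_norm j x = bernpoly j x / fact j"

lemma bern_norm_nth: "bern_norm j x = fps_nth (fps_X / (fps_exp 1 - 1) * fps_exp x) j"
  by (simp add: bern_norm_def bernpoly_def bernpoly_generating_fps(1))

lemma bern_norm_sum:
  "bern_norm j x = (\<Sum>i\<le>j. fps_nth (fps_X / (fps_exp 1 - 1)) i * x ^ (j - i) / fact (j - i))"
  by (simp add: bern_norm_nth fps_mult_nth atLeast0AtMost)

text \<open>Multiplying the generating function by \<open>fps_exp 1 - 1\<close> leaves
  \<open>fps_X\<close>. This difference is the boundary term of the integrations below.\<close>

lemma bern_norm_diff: "bern_norm j 1 - bern_norm j 0 = (if j = 1 then 1 else 0)"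
proof -
  have "bern_norm j 1 - bern_norm j 0 = fps_nth (fps_X / (fps_exp 1 - 1) * (fps_exp 1 - 1)) j"
    by (simp only: bern_norm_nth fps_exp_0 right_diff_distrib fps_sub_nth)
  then show ?thesis unfolding bernpoly_generating_fps(2) by simp
qed

lemma bern_norm_0: "bern_norm 0 x = 1"
proof -
  have "bern_norm 1 1 - bern_norm 1 0 = 1" by (simp add: bern_norm_diff)
  then show ?thesis by (simp add: bern_norm_sum del: One_nat_def) (simp add: fps_mult_nth)
qed

lemma bern_norm_deriv:
  "(bern_norm (Suc j) has_field_derivative bern_norm j x) (at x within A)"
proof -
  let ?c = "\<lambda>i. fps_nth (fps_X / (fps_exp 1 - 1)) i :: real"
  have "((\<lambda>x. \<Sum>i\<le>j. ?c i * x ^ (Suc j - i) / fact (Suc j - i)) has_field_derivative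
      (\<Sum>i\<le>j. ?c i * x ^ (j - i) / fact (j - i))) (at x within A)"
  proof (rule DERIV_sum)
    fix i assume "i \<in> {..j}"
    then have eq: "Suc j - i = Suc (j - i)" by auto
    have "((\<lambda>x. ?c i / fact (Suc d) * x ^ Suc d) has_field_derivative
        ?c i / fact (Suc d) * (real (Suc d) * x ^ d)) (at x within A)" for d
      by (rule DERIV_cmult) (use DERIV_power_Suc[OF DERIV_ident] in simp)
    from this[of "j - i"]
    show "((\<lambda>x. ?c i * x ^ (Suc j - i) / fact (Suc j - i)) has_field_derivative
        ?c i * x ^ (j - i) / fact (j - i)) (at x within A)"
      unfolding eq fact_Suc by (simp add: field_simps del: of_nat_Suc)
  qed
  then have "((\<lambda>x. (\<Sum>i\<le>j. ?c i * x ^ (Suc j - i) / fact (Suc j - i)) + ?c (Suc j)) has_field_derivative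
      (\<Sum>i\<le>j. ?c i * x ^ (j - i) / fact (j - i)) + 0) (at x within A)"
    by (intro DERIV_add) auto
  then show ?thesis
    unfolding bern_norm_sum[abs_def] by simp
qed

lemma continuous_on_bern_norm [continuous_intros]: "continuous_on A (bern_norm j)"
proof (cases j)
  case 0
  then show ?thesis by (simp add: bern_norm_0[abs_def])
next
  case (Suc i)
  then show ?thesis
    by (metis bern_norm_deriv DERIV_continuous_on)
qed

lemma bern_norm_has_integral_0:
  assumes "j > 0"
  shows "(bern_norm j has_integral 0) {0..1}"
proof -
  have "(bern_norm j has_integral (bern_norm (Suc j) 1 - bern_norm (Suc j) 0)) {0..1}"
    by (rule fundamental_theorem_of_calculus)
      (auto intro: bern_norm_deriv simp flip: has_real_derivative_iff_has_vector_derivative)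
  then show ?thesis using assms by (simp add: bern_norm_diff)
qed

text \<open>Each integration by parts divides by 2 pi i (k + 1); the only nonzero boundary term, at
  \<open>j = 1\<close>, starts the recursion.\<close>

lemma bern_norm_Fourier_coeff:
  assumes "j > 0"
  shows "((\<lambda>x. of_real (bern_norm j x) * cis (- (2 * pi * real (Suc k) * x))) has_integral
    (- 1 / (\<i> * of_real (2 * pi * real (Suc k))) ^ j)) {0..1}"
proof -
  let ?w = "2 * pi * real (Suc k)"
  let ?c = "\<i> * complex_of_real ?w"
  let ?e = "\<lambda>x. cis (- (?w * x))"
  have w: "?c \<noteq> 0" by (simp del: of_nat_Suc)
  have e_deriv: "(?e has_vector_derivative (- ?c * ?e x)) (at x within {0..1})" for x
  proof -
    have "((\<lambda>x. exp (\<i> * (of_real (- ?w) * of_real x))) has_vector_derivative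
        (- ?c * exp (\<i> * (of_real (- ?w) * of_real x)))) (at x within {0..1})"
      by (rule has_vector_derivative_real_field)
        (auto intro!: derivative_eq_intros simp: field_simps)
    then show ?thesis by (simp add: cis_conv_exp)
  qed
  have e1: "?e 1 = 1"
  proof -
    have "cis ?w = 1" using cis_multiple_2pi[of "of_nat (Suc k)"] by (simp only: mult_ac) simp
    then show ?thesis using cis_inverse[of ?w] by simp
  qed
  \<comment> \<open>\<open>I\<close> is the coefficient one index lower and \<open>d\<close> the
    jump across the interval. As \<open>?e\<close> is 1 at both ends, integrating the product rule
    gives exactly \<open>d\<close>.\<close>
  have step: "((\<lambda>x. of_real (bern_norm (Suc j) x) * ?e x) has_integral ((I - d) / ?c)) {0..1}"
    if I: "((\<lambda>x. of_real (bern_norm j x) * ?e x) has_integral I) {0..1}"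
      and d: "d = of_real (bern_norm (Suc j) 1 - bern_norm (Suc j) 0)" for j I d
  proof -
    have "((\<lambda>x. of_real (bern_norm (Suc j) x) * (- ?c * ?e x) + of_real (bern_norm j x) * ?e x) has_integral
       (of_real (bern_norm (Suc j) 1) * ?e 1 - of_real (bern_norm (Suc j) 0) * ?e 0)) {0..1}"
    proof (rule fundamental_theorem_of_calculus)
      fix x :: real
      show "((\<lambda>x. of_real (bern_norm (Suc j) x) * ?e x) has_vector_derivative
        of_real (bern_norm (Suc j) x) * (- ?c * ?e x) + of_real (bern_norm j x) * ?e x) (at x within {0..1})"
        by (intro has_vector_derivative_mult e_deriv has_vector_derivative_of_real)
          (simp flip: has_real_derivative_iff_has_vector_derivative add: bern_norm_deriv)
    qed simp
    then have "((\<lambda>x. of_real (bern_norm (Suc j) x) * (- ?c * ?e x) + of_real (bern_norm j x) * ?e x) has_integral d) {0..1}"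
      unfolding e1 d by simp
    from has_integral_mult_right[OF has_integral_diff[OF I this], of "1 / ?c"]
    have "((\<lambda>x. 1 / ?c * (of_real (bern_norm j x) * ?e x
        - (of_real (bern_norm (Suc j) x) * (- ?c * ?e x) + of_real (bern_norm j x) * ?e x)))
      has_integral 1 / ?c * (I - d)) {0..1}" .
    moreover have "1 / c * (u * e - (v * (- c * e) + u * e)) = v * e" if "c \<noteq> 0" for c u v e :: complex
      using that by (simp add: field_simps)
    ultimately show ?thesis using w by (simp only: mult_1_left times_divide_eq_left) simp
  qed
  show ?thesis using assms
  proof (induction j rule: nat_induct_non_zero)
    case 1
    have "(?e has_integral 0) {0..1}"
      using has_integral_cis_int[of "- int (Suc k)"]
      by (simp only: of_int_minus of_int_of_nat_eq mult_minus_left mult_minus_right) simp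
    then have "((\<lambda>x. of_real (bern_norm 0 x) * ?e x) has_integral 0) {0..1}"
      by (simp add: bern_norm_0)
    from step[OF this, of 1] show ?case by (simp add: bern_norm_diff)
  next
    case (Suc n)
    from step[OF Suc.IH, of 0] Suc.hyps show ?case by (simp add: bern_norm_diff field_simps)
  qed
qed

text \<open>At \<open>j = 1\<close> the endpoint values differ, which no absolutely convergent
  series of period 1 can reproduce; from \<open>j = 2\<close> on the coefficients are absolutely
  summable.\<close>

lemma bern_norm_Fourier:
  assumes j: "j \<ge> 2" and x: "x \<in> {0..1}"
  shows "(\<lambda>k. 2 * Re (- 1 / (\<i> * of_real (2 * pi * real (Suc k))) ^ j * cis (2 * pi * real (Suc k) * x)))
    sums bern_norm j x"
proof (rule Fourier_series_sums[OF _ _ _ _ x])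
  have "summable (\<lambda>k. 1 / (2 * pi) ^ j * (1 / real (Suc k) ^ j))"
    using inverse_power_summable[OF j, where 'a = real] 
    by (intro summable_mult) (subst summable_Suc_iff[of "\<lambda>k. 1 / real k ^ j"], simp add: field_simps)
  then show "summable (\<lambda>k. norm (- 1 / (\<i> * complex_of_real (2 * pi * real (Suc k))) ^ j))"
    by (simp add: norm_divide norm_power norm_mult power_mult_distrib del: of_nat_Suc)
qed (use j bern_norm_Fourier_coeff bern_norm_has_integral_0 in \<open>auto intro: continuous_on_bern_norm\<close>)

lemma i_times_real_power:
  "(\<i> * complex_of_real c) ^ (2 * l) = of_real ((-1) ^ l * c ^ (2 * l))"
  "(\<i> * complex_of_real c) ^ (2 * l + 1) = \<i> * of_real ((-1) ^ l * c ^ (2 * l + 1))"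
  by (simp_all add: power_mult_distrib power_mult[of "\<i>"])

lemma bern_norm_even_Fourier:
  assumes "l > 0" "x \<in> {0..1}"
  shows "(\<lambda>k. 2 * (-1) ^ (l + 1) * cos (2 * pi * real (Suc k) * x) / (2 * pi * real (Suc k)) ^ (2 * l))
    sums bern_norm (2 * l) x"
proof -
  have "2 * Re (- 1 / (\<i> * of_real (2 * pi * real (Suc k))) ^ (2 * l) * cis (2 * pi * real (Suc k) * x))
     = 2 * (-1) ^ (l + 1) * cos (2 * pi * real (Suc k) * x) / (2 * pi * real (Suc k)) ^ (2 * l)" for k
  proof -
    have eq: "Re (- 1 / (\<i> * of_real c) ^ (2 * l) * z) = (-1) ^ (l + 1) * Re z / c ^ (2 * l)" for c z
    proof -
      have "- 1 / (\<i> * complex_of_real c) ^ (2 * l) = of_real (- 1 / ((-1) ^ l * c ^ (2 * l)))"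
        unfolding i_times_real_power by simp
      also have "- 1 / ((-1) ^ l * c ^ (2 * l)) = (-1) ^ (l + 1) / c ^ (2 * l)"
        by (cases "even l") auto
      finally show ?thesis
        unfolding times_complex.sel Re_complex_of_real Im_complex_of_real by simp
    qed
    show ?thesis unfolding eq by simp
  qed
  then show ?thesis using bern_norm_Fourier[of "2 * l" x] assms by simp
qed

lemma bern_norm_odd_Fourier:
  assumes "l > 0" "x \<in> {0..1}"
  shows "(\<lambda>k. 2 * (-1) ^ (l + 1) * sin (2 * pi * real (Suc k) * x) / (2 * pi * real (Suc k)) ^ (2 * l + 1))
    sums bern_norm (2 * l + 1) x"
proof -
  have "2 * Re (- 1 / (\<i> * of_real (2 * pi * real (Suc k))) ^ (2 * l + 1) * cis (2 * pi * real (Suc k) * x))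
     = 2 * (-1) ^ (l + 1) * sin (2 * pi * real (Suc k) * x) / (2 * pi * real (Suc k)) ^ (2 * l + 1)" for k
  proof -
    have eq: "Re (- 1 / (\<i> * of_real c) ^ (2 * l + 1) * z) = (-1) ^ (l + 1) * Im z / c ^ (2 * l + 1)" for c z
    proof -
      have "- 1 / (\<i> * complex_of_real c) ^ (2 * l + 1) = \<i> * of_real (1 / ((-1) ^ l * c ^ (2 * l + 1)))"
      proof -
        have "- 1 / (\<i> * complex_of_real y) = \<i> * of_real (1 / y)" for y
          by (simp add: divide_inverse)
        then show ?thesis unfolding i_times_real_power(2) by blast
      qed
      also have "1 / ((-1) ^ l * c ^ (2 * l + 1)) = (-1) ^ l / c ^ (2 * l + 1)"
        by (cases "even l") auto
      finally have eq: "- 1 / (\<i> * complex_of_real c) ^ (2 * l + 1) * z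
          = of_real ((-1) ^ l / c ^ (2 * l + 1)) * (\<i> * z)" by (simp only: mult_ac)
      show ?thesis
        unfolding eq times_complex.sel Re_complex_of_real Im_complex_of_real by simp
    qed
    show ?thesis unfolding eq by simp
  qed
  then show ?thesis using bern_norm_Fourier[of "2 * l + 1" x] assms by simp
qed

section \<open>The Taylor remainder of the exponential quotient as a Fourier series\<close>

text \<open>The factor \<open>- 1 / w ^ j\<close> is kept apart because for w = 2 pi i (k + 1) it is
  the Fourier coefficient of \<open>bern_norm j\<close>.\<close>

lemma inverse_add_geometric_remainder:
  fixes t w :: "'a :: field"
  assumes "w \<noteq> 0" "t + w \<noteq> 0"
  shows "1 / (t + w) - (\<Sum>j=1..n. (-1) ^ j * t ^ (j - 1) * (- 1 / w ^ j)) = (-1) ^ n * (t / w) ^ n / (t + w)"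
proof (induction n)
  case 0
  then show ?case by simp
next
  case (Suc n)
  have eq: "x / (t + w) - x / w = - (x * (t / w)) / (t + w)" for x
    using assms by (simp add: field_simps)
  have "1 / (t + w) - (\<Sum>j=1..Suc n. (-1) ^ j * t ^ (j - 1) * (- 1 / w ^ j))
      = (-1) ^ n * (t / w) ^ n / (t + w) - (-1) ^ Suc n * t ^ n * (- 1 / w ^ Suc n)"
    using Suc by (simp add: algebra_simps)
  also have "(-1) ^ Suc n * t ^ n * (- 1 / w ^ Suc n) = (-1) ^ n * (t / w) ^ n / w"
    by (simp add: power_divide mult.commute)
  also have "(-1) ^ n * (t / w) ^ n / (t + w) - (-1) ^ n * (t / w) ^ n / w = (-1) ^ Suc n * (t / w) ^ Suc n / (t + w)"
    unfolding eq by (simp add: mult_ac)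
  finally show ?case .
qed

text \<open>The Fourier coefficients of the sum against cis (-2 pi k x) are
  1 / (t + w) + sum_{j=1..2m} (-1)^j t^(j-1) / w^j with w = 2 pi i k; the geometric sum collapses them to
  (t / w)^(2m) / (t + w).\<close>
lemma exp_quotient_expansion:
  fixes t x :: real
  assumes t: "t > 0" and m: "m > 0" and x: "x \<in> {0..1}"
  shows "(\<lambda>k. (-1) ^ m * (t / (2 * pi * real (Suc k))) ^ (2 * m)
      * (2 * t * cos (2 * pi * real (Suc k) * x) + 2 * (2 * pi * real (Suc k)) * sin (2 * pi * real (Suc k) * x))
      / (t ^ 2 + (2 * pi * real (Suc k)) ^ 2))
    sums (exp (- x * t) / (1 - exp (- t)) - 1 / t - (\<Sum>j=1..2*m. (-1) ^ j * bern_norm j x * t ^ (j - 1)))"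
proof -
  \<comment> \<open>The generating function of \<open>bern_norm\<close> at \<open>- t\<close> is
    \<open>t\<close> times the exponential quotient. This explains the signs
    \<open>(-1) ^ j\<close>, and \<open>1 / t\<close> is the term of index 0.\<close>
  define h where "h x = exp (- x * t) / (1 - exp (- t)) - 1 / t
    - (\<Sum>j=1..2*m. (-1) ^ j * bern_norm j x * t ^ (j - 1))" for x
  define C where "C k = 2 * pi * real (Suc k)" for k
  define c where "c k = (of_real t / (\<i> * of_real (C k))) ^ (2 * m) / (of_real t + \<i> * of_real (C k))" for k
  have C_pos: "C k > 0" for k by (simp add: C_def)
  have et: "1 - exp (- t) \<noteq> 0" using t by simp
  have "(\<lambda>k. 2 * Re (c k * cis (2 * pi * real (Suc k) * x))) sums h x"
  proof (rule Fourier_series_sums[OF _ _ _ _ x])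
    show "continuous_on {0..1} h"
      unfolding h_def by (intro continuous_intros) (use et t in auto)
    \<comment> \<open>The mean of the exponential quotient is exactly the pole term
      \<open>1 / t\<close>, and all Bernoulli terms of positive index have mean 0.\<close>
    show "(h has_integral 0) {0..1}"
    proof -
      have 1: "((\<lambda>x. exp (- x * t) / (1 - exp (- t))) has_integral
          ((- exp (- 1 * t) / (t * (1 - exp (- t)))) - (- exp (- 0 * t) / (t * (1 - exp (- t)))))) {0..1}"
      proof (rule fundamental_theorem_of_calculus)
        fix x :: real
        have "((\<lambda>x. - exp (- x * t) / (t * d)) has_field_derivative exp (- x * t) / d) (at x within {0..1})"
          if "d \<noteq> 0" for d :: real
          using that t by (auto intro!: derivative_eq_intros simp: field_simps)
        from this[OF et] show "((\<lambda>x. - exp (- x * t) / (t * (1 - exp (- t)))) has_vector_derivative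
            exp (- x * t) / (1 - exp (- t))) (at x within {0..1})"
          by (simp add: has_real_derivative_iff_has_vector_derivative)
      qed simp
      have eq: "((- exp (- 1 * t) / (t * (1 - exp (- t)))) - (- exp (- 0 * t) / (t * (1 - exp (- t))))) = 1 / t"
        using t et by (simp add: field_simps)
      have 2: "((\<lambda>x::real. 1 / t) has_integral 1 / t) {0..1}"
        using has_integral_const_real[of "1/t" 0 1] by simp
      have 3: "((\<lambda>x. \<Sum>j=1..2*m. (-1) ^ j * bern_norm j x * t ^ (j - 1)) has_integral
          (\<Sum>j=1..2*m. (-1) ^ j * 0 * t ^ (j - 1))) {0..1}"
        by (intro has_integral_sum has_integral_mult_left has_integral_mult_right bern_norm_has_integral_0) auto
      show ?thesis
        unfolding h_def using has_integral_diff[OF has_integral_diff[OF 1[unfolded eq] 2] 3] by simp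
    qed
    fix k
    let ?w = "\<i> * complex_of_real (C k)"
    let ?e = "\<lambda>x. cis (- (C k * x))"
    have w: "?w \<noteq> 0" "of_real t + ?w \<noteq> 0" using C_pos[of k] t by (auto simp: complex_eq_iff)
    \<comment> \<open>Hence the antiderivative changes over the interval by a multiple of
      \<open>1 - exp (- t)\<close>, which cancels the denominator and leaves
      \<open>1 / (of_real t + ?w)\<close>.\<close>
    have e1: "exp (- ?w) = 1"
    proof -
      have "cis (C k) = 1" using cis_multiple_2pi[of "of_nat (Suc k)"] by (simp only: C_def mult_ac) simp
      then have "cis (- C k) = 1" using cis_inverse[of "C k"] by simp
      then show ?thesis by (simp add: cis_conv_exp)
    qed
    have 1: "((\<lambda>x. of_real (exp (- x * t) / (1 - exp (- t))) * ?e x) has_integral 1 / (of_real t + ?w)) {0..1}"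
    proof -
      let ?u = "of_real t + ?w" and ?d = "complex_of_real (1 - exp (- t))"
      have d: "?d \<noteq> 0" using et by simp
      have "((\<lambda>x. exp (- ?u * of_real x) / ?d) has_integral
        (- exp (- ?u * of_real 1) / (?u * ?d) - (- exp (- ?u * of_real 0) / (?u * ?d)))) {0..1}"
      proof (rule fundamental_theorem_of_calculus)
        fix x :: real
        show "((\<lambda>x. - exp (- ?u * of_real x) / (?u * ?d)) has_vector_derivative exp (- ?u * of_real x) / ?d)
            (at x within {0..1})"
        proof (rule has_vector_derivative_real_field)
          have "((\<lambda>x. - exp (- u * x) / (u * d)) has_field_derivative exp (- u * x) / d) (at x within S)"
            if "u \<noteq> 0" "d \<noteq> 0" for u d x :: complex and S
            using that by (auto intro!: derivative_eq_intros simp: field_simps)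
          from this[OF w(2) d] show "((\<lambda>x. - exp (- ?u * x) / (?u * ?d)) has_field_derivative
            exp (- ?u * of_real x) / ?d) (at (of_real x))" .
        qed
      qed simp
      moreover have "exp (- ?u * of_real x) / ?d = of_real (exp (- x * t) / (1 - exp (- t))) * ?e x" for x :: real
        by (simp add: cis_conv_exp exp_of_real[symmetric] exp_add[symmetric] algebra_simps)
      moreover have "- exp (- ?u * of_real 1) / (?u * ?d) - (- exp (- ?u * of_real 0) / (?u * ?d)) = 1 / ?u"
      proof -
        have "exp (- ?u * of_real 1) = exp (of_real (- t)) * exp (- ?w)"
          by (simp add: exp_add[symmetric])
        also have "\<dots> = of_real (exp (- t))"
          unfolding e1 by (simp only: exp_of_real mult_1_right)
        finally have ex: "exp (- ?u * of_real 1) = of_real (exp (- t))" .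
        have "- z / (u * (1 - z)) - (- 1 / (u * (1 - z))) = 1 / u" if "u \<noteq> 0" "1 - z \<noteq> 0" for u z :: complex
          using that by (simp add: divide_simps)
        from this[OF w(2), of "of_real (exp (- t))"] d show ?thesis
          unfolding ex by simp
      qed
      ultimately show ?thesis by (simp only:)
    qed
    have 2: "((\<lambda>x. of_real (1 / t) * ?e x) has_integral of_real (1 / t) * 0) {0..1}"
    proof (rule has_integral_mult_right)
      show "(?e has_integral 0) {0..1}"
        using has_integral_cis_int[of "- int (Suc k)"] unfolding C_def
        by (simp only: of_int_minus of_int_of_nat_eq mult_minus_left mult_minus_right) simp
    qed
    have 3: "((\<lambda>x. \<Sum>j=1..2*m. of_real ((-1) ^ j * t ^ (j - 1)) * (of_real (bern_norm j x) * ?e x)) has_integral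
      (\<Sum>j=1..2*m. of_real ((-1) ^ j * t ^ (j - 1)) * (- 1 / ?w ^ j))) {0..1}"
      unfolding C_def by (intro has_integral_sum has_integral_mult_right bern_norm_Fourier_coeff) auto
    have "1 / (of_real t + ?w) - of_real (1/t) * 0
        - (\<Sum>j=1..2*m. of_real ((-1) ^ j * t ^ (j - 1)) * (- 1 / ?w ^ j)) = c k"
      using inverse_add_geometric_remainder[OF w, of "2 * m"] by (simp add: c_def)
    with has_integral_diff[OF has_integral_diff[OF 1 2] 3]
    have "((\<lambda>x. of_real (exp (- x * t) / (1 - exp (- t))) * ?e x - of_real (1 / t) * ?e x
       - (\<Sum>j=1..2*m. of_real ((-1) ^ j * t ^ (j - 1)) * (of_real (bern_norm j x) * ?e x))) has_integral c k) {0..1}"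
      by (simp only:)
    moreover have "of_real (exp (- x * t) / (1 - exp (- t))) * ?e x - of_real (1 / t) * ?e x
       - (\<Sum>j=1..2*m. of_real ((-1) ^ j * t ^ (j - 1)) * (of_real (bern_norm j x) * ?e x))
       = of_real (h x) * cis (- (2 * pi * real (Suc k) * x))" for x
      unfolding h_def C_def of_real_diff left_diff_distrib of_real_sum sum_distrib_right
      by (simp add: mult_ac)
    ultimately show "((\<lambda>x. of_real (h x) * cis (- (2 * pi * real (Suc k) * x))) has_integral c k) {0..1}"
      by (simp only:)
  next
    \<comment> \<open>Bounding the denominator below by \<open>t\<close> alone leaves decay of order
      \<open>2 * m\<close>, which is at least 2.\<close>
    show "summable (\<lambda>k. norm (c k))"
    proof (rule summable_comparison_test')
      show "summable (\<lambda>k. t ^ (2 * m) / t * (1 / real (Suc k) ^ (2 * m)))"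
        using inverse_power_summable[of "2 * m", where 'a = real] m
        by (intro summable_mult) (subst summable_Suc_iff[of "\<lambda>k. 1 / real k ^ (2 * m)"], simp add: field_simps)
      fix k
      have 1: "real (Suc k) \<le> C k"
        using mult_right_mono[of 1 "2 * pi" "real (Suc k)"] pi_gt3 by (simp add: C_def)
      have 2: "t \<le> norm (of_real t + \<i> * of_real (C k))"
        using complex_Re_le_cmod[of "of_real t + \<i> * of_real (C k)"] by simp
      have "norm (c k) = t ^ (2 * m) / C k ^ (2 * m) / norm (of_real t + \<i> * of_real (C k))"
        using t C_pos[of k] by (simp add: c_def norm_divide norm_power norm_mult power_divide)
      also have "\<dots> \<le> t ^ (2 * m) / real (Suc k) ^ (2 * m) / t"
        using 1 2 t C_pos[of k] by (intro frac_le power_mono) auto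
      finally show "norm (norm (c k)) \<le> t ^ (2 * m) / t * (1 / real (Suc k) ^ (2 * m))" by (simp add: mult.commute)
    qed
  qed
  moreover have "2 * Re (c k * cis (C k * x)) =
      (-1) ^ m * (t / C k) ^ (2 * m) * (2 * t * cos (C k * x) + 2 * C k * sin (C k * x)) / (t ^ 2 + C k ^ 2)" for k
  proof -
    have "(of_real t / (\<i> * of_real (C k))) ^ (2 * m) = complex_of_real ((-1) ^ m * (t / C k) ^ (2 * m))"
    proof -
      have "(of_real t / (\<i> * of_real (C k))) ^ 2 = complex_of_real (- ((t / C k) ^ 2))"
        by (simp add: power_divide power_mult_distrib)
      then show ?thesis
        unfolding power_mult by (metis of_real_power power_minus)
    qed
    moreover have "1 / (of_real t + \<i> * of_real (C k)) = Complex (t / (t ^ 2 + C k ^ 2)) (- C k / (t ^ 2 + C k ^ 2))"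
      by (simp add: complex_eq_iff Re_divide Im_divide)
    ultimately have "c k = of_real ((-1) ^ m * (t / C k) ^ (2 * m))
        * Complex (t / (t ^ 2 + C k ^ 2)) (- C k / (t ^ 2 + C k ^ 2))"
      unfolding c_def by (metis divide_inverse mult_1)
    then show ?thesis
      by (simp add: times_complex.sel add_divide_distrib algebra_simps del: of_nat_Suc of_real_mult of_real_power of_real_divide)
  qed
  ultimately show ?thesis unfolding h_def by (simp only: C_def)
qed

section \<open>Digamma reflection and roots of unity\<close>

text \<open>The derivative of the reflection formula, taken for the entire function
  \<open>rGamma\<close>; dividing by the formula itself would give the cotangent.\<close>

lemma Digamma_reflection:
  fixes z :: complex
  assumes "z \<notin> \<int>"
  shows "(Digamma (1 - z) - Digamma z) * sin (of_real pi * z) = of_real pi * cos (of_real pi * z)"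
proof -
  have nz: "z \<notin> \<int>\<^sub>\<le>\<^sub>0" "1 - z \<notin> \<int>\<^sub>\<le>\<^sub>0"
    using assms nonpos_Ints_subset_Ints Ints_diff[of 1 "1 - z"] by auto
  have "((\<lambda>z. rGamma z * rGamma (1 - z)) has_field_derivative
      (- rGamma z * Digamma z * rGamma (1 - z) + (- rGamma (1 - z) * Digamma (1 - z) * (-1)) * rGamma z)) (at z)"
    using nz by (auto intro!: derivative_eq_intros)
  moreover have "((\<lambda>z. sin (of_real pi * z) / of_real pi) has_field_derivative cos (of_real pi * z)) (at z)"
    by (auto intro!: derivative_eq_intros)
  ultimately have "- rGamma z * Digamma z * rGamma (1 - z) + (- rGamma (1 - z) * Digamma (1 - z) * (-1)) * rGamma z
      = cos (of_real pi * z)"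
    unfolding rGamma_reflection_complex using DERIV_unique by blast
  then have "(Digamma (1 - z) - Digamma z) * (rGamma z * rGamma (1 - z)) = cos (of_real pi * z)"
    by (simp add: algebra_simps)
  then show ?thesis
    unfolding rGamma_reflection_complex by (simp add: field_simps)
qed

section \<open>Series with denominator n^2 + v^2\<close>

lemma sums_Digamma_plus_1:
  fixes z :: complex
  assumes "z + 1 \<noteq> 0"
  shows "(\<lambda>n. 1 / of_nat (Suc n) - 1 / (of_nat (Suc n) + z)) sums (Digamma (z + 1) + euler_mascheroni)"
  using summable_sums[OF summable_Digamma[OF assms]] unfolding Digamma_def
  by (simp add: inverse_eq_divide add_ac)

lemma i_times_not_Ints:
  assumes "Re v > 0" shows "\<i> * v \<notin> \<int>"
proof
  assume "\<i> * v \<in> \<int>"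
  then obtain n where "\<i> * v = of_int n" by (elim Ints_cases)
  then have "Im (\<i> * v) = 0" by simp
  then show False using assms by simp
qed

lemma square_sum_factor:
  fixes v :: complex
  assumes "Re v > 0" and "x \<noteq> 0"
  shows "of_real x + \<i> * v \<noteq> 0" "of_real x - \<i> * v \<noteq> 0"
    "(of_real x + \<i> * v) * (of_real x - \<i> * v) = of_real x ^ 2 + v ^ 2"
    "of_real x ^ 2 + v ^ 2 \<noteq> 0"
proof -
  show 1: "of_real x + \<i> * v \<noteq> 0" "of_real x - \<i> * v \<noteq> 0"
    using assms by (auto simp: complex_eq_iff)
  show 2: "(of_real x + \<i> * v) * (of_real x - \<i> * v) = of_real x ^ 2 + v ^ 2"
    by (simp add: algebra_simps power2_eq_square)
  show "of_real x ^ 2 + v ^ 2 \<noteq> 0"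
    using 1 by (simp flip: 2)
qed

text \<open>The Digamma series at \<open>\<i> * v\<close> and \<open>- \<i> * v\<close> differ by a
  multiple of this series, and reflection evaluates the difference. The hyperbolic cotangent is
  written \<open>1 + 2 / (exp (2 * of_real pi * v) - 1)\<close> to expose the exponential term;
  \<open>1 / (2 * v ^ 2)\<close> is half of the absent summand at 0 and comes from Digamma(z + 1) =
  Digamma(z) + 1/z.\<close>

lemma sums_coth:
  assumes v: "Re v > 0"
  shows "(\<lambda>n. 1 / (of_nat (Suc n) ^ 2 + v ^ 2)) sums
    (of_real pi / (2 * v) * (1 + 2 / (exp (2 * of_real pi * v) - 1)) - 1 / (2 * v ^ 2))"
proof -
  let ?z = "\<i> * v"
  have z: "?z \<notin> \<int>" using v by (rule i_times_not_Ints)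
  have v0: "v \<noteq> 0" using v by auto
  have z1: "?z + 1 \<noteq> 0" "- ?z + 1 \<noteq> 0" "?z \<noteq> 0"
  proof -
    have "?z \<noteq> 1" "?z \<noteq> - 1" using z by (metis Ints_1, metis Ints_1 Ints_minus)
    then show "?z + 1 \<noteq> 0" "- ?z + 1 \<noteq> 0"
      by (metis add_eq_0_iff add.commute, metis add.commute add_uminus_conv_diff right_minus_eq)
  qed (use v0 in auto)
  have "(\<lambda>n. (1 / of_nat (Suc n) - 1 / (of_nat (Suc n) + (- ?z))) - (1 / of_nat (Suc n) - 1 / (of_nat (Suc n) + ?z)))
      sums ((Digamma (- ?z + 1) + euler_mascheroni) - (Digamma (?z + 1) + euler_mascheroni))"
    by (intro sums_diff sums_Digamma_plus_1 z1)
  moreover have "(1 / of_nat (Suc n) - 1 / (of_nat (Suc n) + (- ?z))) - (1 / of_nat (Suc n) - 1 / (of_nat (Suc n) + ?z))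
      = - 2 * ?z * (1 / (of_nat (Suc n) ^ 2 + v ^ 2))" for n
  proof -
    have "1 / (x + z) - 1 / (x - z) = - 2 * z * (1 / ((x + z) * (x - z)))"
      if "x + z \<noteq> 0" "x - z \<noteq> 0" for x z :: complex
      using that by (simp add: field_simps)
    from this[of "of_nat (Suc n)" ?z] square_sum_factor[OF v, of "real (Suc n)"]
    show ?thesis by (simp del: of_nat_Suc)
  qed
  ultimately have "(\<lambda>n. - 2 * ?z * (1 / (of_nat (Suc n) ^ 2 + v ^ 2))) sums (Digamma (- ?z + 1) - Digamma (?z + 1))"
    by simp
  from sums_mult[OF this, of "- 1 / (2 * ?z)"]
  have "(\<lambda>n. 1 / (of_nat (Suc n) ^ 2 + v ^ 2)) sums (- 1 / (2 * ?z) * (Digamma (- ?z + 1) - Digamma (?z + 1)))"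
    using v0 by (simp add: mult.assoc[symmetric] del: of_nat_Suc)
  moreover have "- 1 / (2 * ?z) * (Digamma (- ?z + 1) - Digamma (?z + 1))
      = of_real pi / (2 * v) * (1 + 2 / (exp (2 * of_real pi * v) - 1)) - 1 / (2 * v ^ 2)"
  proof -
    let ?E = "exp (of_real pi * v)"
    have E2: "exp (2 * of_real pi * v) = ?E ^ 2"
      by (simp add: exp_double[symmetric] mult_ac)
    \<comment> \<open>This norm is \<open>exp (2 * pi * Re v)\<close>, and \<open>Re v\<close> is
      positive.\<close>
    have "norm (?E ^ 2) \<noteq> 1"
      using v by (simp flip: E2)
    then have E: "?E ^ 2 - 1 \<noteq> 0" by (metis norm_one right_minus_eq)
    have arg: "\<i> * (of_real pi * ?z) = - (of_real pi * v)"
      by (simp add: algebra_simps)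
    have s: "sin (of_real pi * ?z) = (inverse ?E - ?E) / (2 * \<i>)"
      and c: "cos (of_real pi * ?z) = (inverse ?E + ?E) / 2"
      unfolding sin_exp_eq cos_exp_eq arg exp_minus by simp_all
    have e0: "?E \<noteq> 0" by simp
    have s0: "inverse ?E - ?E \<noteq> 0"
      using E by (simp add: field_simps power2_eq_square)
    have "Digamma (1 - ?z) - Digamma ?z = of_real pi * \<i> * ((inverse ?E + ?E) / (inverse ?E - ?E))"
    proof -
      have "D = p * \<i> * (c / s)" if "D * (s / (2 * \<i>)) = p * (c / 2)" "s \<noteq> 0" for D p c s :: complex
      proof -
        have 1: "- (\<i> * (D * s)) = c * p" using that(1) by (simp add: field_simps)
        have "D * s = \<i> * - (\<i> * (D * s))" by (simp flip: mult.assoc)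
        also have "\<dots> = p * \<i> * c" unfolding 1 by simp
        finally show ?thesis using that(2) by (simp add: field_simps)
      qed
      from this[OF Digamma_reflection[OF z, unfolded s c] s0] show ?thesis .
    qed
    also have "(inverse ?E + ?E) / (inverse ?E - ?E) = - (1 + 2 / (?E ^ 2 - 1))"
    proof -
      have "(inverse e + e) / (inverse e - e) = - (1 + 2 / (e ^ 2 - 1))" if "e \<noteq> 0" "e ^ 2 - 1 \<noteq> 0" for e :: complex
      proof -
        have "(inverse e + e) / (inverse e - e) = (e * (inverse e + e)) / (e * (inverse e - e))"
          using that by simp
        also have "\<dots> = (1 + e ^ 2) / (1 - e ^ 2)"
          using that(1) by (simp add: distrib_left right_diff_distrib power2_eq_square)
        also have "\<dots> = - (1 + 2 / (e ^ 2 - 1))"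
          using that(2) by (simp add: divide_simps) (simp add: algebra_simps)
        finally show ?thesis .
      qed
      from this[OF e0 E] show ?thesis .
    qed
    finally have D: "Digamma (- ?z + 1) = Digamma ?z - of_real pi * \<i> * (1 + 2 / (?E ^ 2 - 1))"
      by (simp add: algebra_simps)
    show ?thesis
      unfolding D Digamma_plus1[OF z1(3)] E2 using v0
      by (simp add: divide_simps) (simp add: algebra_simps power2_eq_square)
  qed
  ultimately show ?thesis by simp
qed

text \<open>Now the two Digamma series are averaged instead of subtracted. The summands 1/n, needed
  for convergence, bring in Euler's constant; the shifts 1/z and -1/z cancel, so the arguments
  become unshifted.\<close>

lemma sums_Digamma_pair:
  assumes v: "Re v > 0"
  shows "(\<lambda>n. 1 / of_nat (Suc n) - of_nat (Suc n) / (of_nat (Suc n) ^ 2 + v ^ 2)) sums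
    (euler_mascheroni + (Digamma (\<i> * v) + Digamma (- \<i> * v)) / 2)"
proof -
  let ?z = "\<i> * v"
  have z: "?z \<notin> \<int>" using v by (rule i_times_not_Ints)
  have v0: "v \<noteq> 0" using v by auto
  have z1: "?z + 1 \<noteq> 0" "- ?z + 1 \<noteq> 0" "?z \<noteq> 0" "- ?z \<noteq> 0"
  proof -
    have "?z \<noteq> 1" "?z \<noteq> - 1" using z by (metis Ints_1, metis Ints_1 Ints_minus)
    then show "?z + 1 \<noteq> 0" "- ?z + 1 \<noteq> 0"
      by (metis add_eq_0_iff add.commute, metis add.commute add_uminus_conv_diff right_minus_eq)
  qed (use v0 in auto)
  have "(\<lambda>n. ((1 / of_nat (Suc n) - 1 / (of_nat (Suc n) + ?z)) + (1 / of_nat (Suc n) - 1 / (of_nat (Suc n) + (- ?z)))) / 2)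
      sums (((Digamma (?z + 1) + euler_mascheroni) + (Digamma (- ?z + 1) + euler_mascheroni)) / 2)"
    by (intro sums_add sums_divide sums_Digamma_plus_1 z1)
  moreover have "((1 / of_nat (Suc n) - 1 / (of_nat (Suc n) + ?z)) + (1 / of_nat (Suc n) - 1 / (of_nat (Suc n) + (- ?z)))) / 2
      = 1 / of_nat (Suc n) - of_nat (Suc n) / (of_nat (Suc n) ^ 2 + v ^ 2)" for n
  proof -
    have "1 / (x + z) + 1 / (x - z) = 2 * x / ((x + z) * (x - z))"
      if "x + z \<noteq> 0" "x - z \<noteq> 0" for x z :: complex
      using that by (simp add: field_simps)
    from this[of "of_nat (Suc n)" ?z] square_sum_factor[OF v, of "real (Suc n)"]
    have eq: "1 / (of_nat (Suc n) + ?z) + 1 / (of_nat (Suc n) - ?z) = 2 * (of_nat (Suc n) / (of_nat (Suc n) ^ 2 + v ^ 2))"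
      by (simp del: of_nat_Suc)
    have "((a - b) + (a - c)) / 2 = a - d" if "b + c = 2 * d" for a b c d :: complex
    proof -
      have "(a - b) + (a - c) = 2 * (a - d)" using that by (simp add: algebra_simps)
      then show ?thesis by simp
    qed
    from this[OF eq] show ?thesis by (simp only: diff_conv_add_uminus)
  qed
  moreover have "((Digamma (?z + 1) + euler_mascheroni) + (Digamma (- ?z + 1) + euler_mascheroni)) / 2
      = euler_mascheroni + (Digamma (\<i> * v) + Digamma (- \<i> * v)) / 2"
    unfolding Digamma_plus1[OF z1(3)] Digamma_plus1[OF z1(4)] by (simp add: field_simps)
  ultimately show ?thesis by (simp only:)
qed

section \<open>Sums over roots of unity\<close>

lemma sum_powi_symmetric:
  fixes w :: complex
  assumes "w \<noteq> 0"
  shows "(\<Sum>j = - int M..int M. w powi j) = w powi (- int M) * (\<Sum>q<2 * M + 1. w ^ q)"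
proof -
  have "(\<Sum>j = - int M..int M. w powi j) = (\<Sum>q<2 * M + 1. w powi (- int M) * w ^ q)"
    by (rule sum.reindex_bij_witness[of _ "\<lambda>q. int q - int M" "\<lambda>j. nat (j + int M)"])
      (use assms in \<open>auto simp: power_int_add[symmetric] simp flip: power_int_of_nat\<close>)
  then show ?thesis by (simp only: sum_distrib_left)
qed

lemma sum_roots_of_unity:
  fixes N :: nat and w :: complex
  assumes N: "N = 2 * M + 1" and w: "w ^ N = 1"
  shows "(\<Sum>j = - int M..int M. w powi j) = (if w = 1 then of_nat N else 0)"
proof -
  have w0: "w \<noteq> 0" using w N by auto
  show ?thesis
    unfolding sum_powi_symmetric[OF w0] N[symmetric] using w by (simp add: sum_gp_strict)
qed

lemma sum_alternating: "(\<Sum>j = - int M..int M. (-1) powi j) = (-1 :: complex) ^ M"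
proof -
  have "(\<Sum>q<2 * M + 1. (-1 :: complex) ^ q) = 1"
    by (simp add: sum_gp_strict)
  moreover have "(-1 :: complex) powi (- int M) = (-1) ^ M"
    by (cases "even M") (simp_all add: power_int_minus)
  ultimately show ?thesis
    by (subst sum_powi_symmetric) (simp_all del: sum.lessThan_Suc)
qed

text \<open>For \<open>N = 2 * M + 1\<close> the indices from \<open>- M\<close> to \<open>M\<close>
  give exactly the 2N-th roots of unity in the open right half-plane, and their squares run through
  all N-th roots of unity.\<close>

definition hroot :: "nat \<Rightarrow> int \<Rightarrow> complex" where
  "hroot N j = cis (pi * real_of_int j / real N)"

lemma hroot_nonzero [simp]: "hroot N j \<noteq> 0"
  by (simp add: hroot_def)

lemma hroot_power: "hroot N j ^ p = hroot N (int p * j)"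
  by (simp add: hroot_def Complex.DeMoivre mult_ac)

lemma hroot_add: "hroot N (i + j) = hroot N i * hroot N j"
  by (simp add: hroot_def cis_mult algebra_simps add_divide_distrib)

lemma hroot_multiple:
  assumes "N > 0" shows "hroot N (int N * j) = (-1) powi j"
proof -
  have "hroot N (int N * j) = cis (of_int j * pi)"
    using assms by (simp add: hroot_def mult_ac)
  also have "\<dots> = cis pi powi j" unfolding cis_power_int ..
  finally show ?thesis by simp
qed

lemma hroot_sum:
  assumes N: "N = 2 * M + 1"
  shows "(\<Sum>j = - int M..int M. hroot N (2 * int p * j)) = (if N dvd p then of_nat N else 0)"
proof -
  let ?w = "hroot N (2 * int p)"
  have powi: "?w powi j = hroot N (2 * int p * j)" for j
    by (simp add: hroot_def cis_power_int mult_ac)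
  have "?w ^ N = hroot N (int N * (2 * int p))" by (simp add: hroot_power)
  also have "\<dots> = 1" using N by (subst hroot_multiple) (auto simp: power_int_mult)
  finally have wN: "?w ^ N = 1" .
  have "?w = 1 \<longleftrightarrow> N dvd p"
  proof -
    have eq: "?w = exp (2 * of_real pi * \<i> * of_nat p / of_nat N)"
      by (simp add: hroot_def cis_conv_exp mult_ac)
    show ?thesis
    proof
      assume "N dvd p"
      then obtain q where "p = N * q" by auto
      then have "2 * int p = int N * (2 * int q)" by simp
      then show "?w = 1" using hroot_multiple[of N "2 * int q"] N
        by (simp only: power_int_mult) simp
    next
      assume "?w = 1"
      then show "N dvd p"
        using complex_root_unity_eq_1[of N p] eq N by (simp del: of_nat_Suc of_nat_add)
    qed
  qed
  with sum_roots_of_unity[OF N wN] show ?thesis by (simp add: powi)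
qed

text \<open>For \<open>u ^ N = 1\<close> the fraction \<open>1 / (1 - s * u)\<close> is a geometric
  sum of \<open>N\<close> terms over \<open>1 - s ^ N\<close>. Orthogonality retains the single
  exponent \<open>i < N\<close> with \<open>N dvd p + i\<close>, which is \<open>q\<close>.\<close>

lemma roots_partial_fractions:
  fixes s :: complex
  assumes N: "N = 2 * M + 1" and s: "s ^ N \<noteq> 1" and pq: "N dvd p + q" "q < N"
  shows "(\<Sum>j = - int M..int M. hroot N (2 * int p * j) / (1 - s * hroot N (2 * j)))
    = of_nat N * s ^ q / (1 - s ^ N)"
proof -
  have uN: "hroot N (2 * j) ^ N = 1" for j
    unfolding hroot_power using N by (subst hroot_multiple) (auto simp: power_int_mult)
  have div: "1 / (1 - s * hroot N (2 * j)) = (\<Sum>i<N. (s * hroot N (2 * j)) ^ i) / (1 - s ^ N)" for j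
  proof -
    have "(s * hroot N (2 * j)) ^ N = s ^ N" using uN by (simp add: power_mult_distrib)
    moreover from this have "s * hroot N (2 * j) \<noteq> 1" using s by auto
    ultimately show ?thesis using s by (simp add: sum_gp_strict)
  qed
  have "(\<Sum>j = - int M..int M. hroot N (2 * int p * j) / (1 - s * hroot N (2 * j)))
    = (\<Sum>j = - int M..int M. (\<Sum>i<N. s ^ i * hroot N (2 * int (p + i) * j)) / (1 - s ^ N))"
  proof (rule sum.cong[OF refl])
    fix j
    have "hroot N (2 * int p * j) / (1 - s * hroot N (2 * j))
        = hroot N (2 * int p * j) * (1 / (1 - s * hroot N (2 * j)))" by simp
    also have "\<dots> = (\<Sum>i<N. hroot N (2 * int p * j) * (s * hroot N (2 * j)) ^ i) / (1 - s ^ N)"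
      unfolding div by (simp add: sum_distrib_left)
    also have "(\<Sum>i<N. hroot N (2 * int p * j) * (s * hroot N (2 * j)) ^ i)
        = (\<Sum>i<N. s ^ i * hroot N (2 * int (p + i) * j))"
    proof (rule sum.cong[OF refl])
      fix i
      have "hroot N (2 * int (p + i) * j) = hroot N (2 * int p * j) * hroot N (2 * j) ^ i"
        unfolding hroot_power hroot_add[symmetric] by (simp add: algebra_simps)
      then show "hroot N (2 * int p * j) * (s * hroot N (2 * j)) ^ i = s ^ i * hroot N (2 * int (p + i) * j)"
        by (simp add: power_mult_distrib)
    qed
    finally show "hroot N (2 * int p * j) / (1 - s * hroot N (2 * j))
      = (\<Sum>i<N. s ^ i * hroot N (2 * int (p + i) * j)) / (1 - s ^ N)" .
  qed
  also have "\<dots> = (\<Sum>j = - int M..int M. \<Sum>i<N. s ^ i * hroot N (2 * int (p + i) * j)) / (1 - s ^ N)"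
    by (simp add: sum_divide_distrib)
  also have "(\<Sum>j = - int M..int M. \<Sum>i<N. s ^ i * hroot N (2 * int (p + i) * j))
      = (\<Sum>i<N. s ^ i * (\<Sum>j = - int M..int M. hroot N (2 * int (p + i) * j)))"
    by (subst sum.swap) (simp add: sum_distrib_left)
  also have "\<dots> = (\<Sum>i<N. if i = q then of_nat N * s ^ q else 0)"
  proof (rule sum.cong[OF refl])
    fix i assume "i \<in> {..<N}"
    have "N dvd p + i \<longleftrightarrow> i = q"
    proof
      assume "N dvd p + i"
      then have "N dvd (p + i) - (p + q)" "N dvd (p + q) - (p + i)"
        using dvd_diff_nat[of N "p + i" "p + q"] dvd_diff_nat[of N "p + q" "p + i"] pq(1) by blast+
      then show "i = q"
        using \<open>i \<in> {..<N}\<close> pq(2) nat_dvd_not_less[of "i - q" N] nat_dvd_not_less[of "q - i" N]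
          less_imp_diff_less[of i N q]
        by (cases i q rule: linorder_cases) auto
    qed (use pq in auto)
    then show "s ^ i * (\<Sum>j = - int M..int M. hroot N (2 * int (p + i) * j)) = (if i = q then of_nat N * s ^ q else 0)"
      unfolding hroot_sum[OF N] by auto
  qed
  also have "\<dots> = of_nat N * s ^ q" using pq by simp
  finally show ?thesis .
qed

section \<open>Partial fractions of rational functions with denominator x^2N + r^2N\<close>

lemma hroot_Re_pos:
  assumes N: "N = 2 * M + 1" and j: "j \<in> {- int M..int M}"
  shows "Re (hroot N j) > 0"
proof -
  have "\<bar>of_int j\<bar> < real N / 2"
    using N j by (simp add: abs_less_iff) linarith
  then have "pi * \<bar>of_int j\<bar> < pi * (real N / 2)"
    by (intro mult_strict_left_mono) auto
  then have "pi * \<bar>of_int j\<bar> / real N < pi / 2"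
    using N by (simp add: divide_less_eq)
  then have "\<bar>pi * of_int j / real N\<bar> < pi / 2"
    by (simp add: abs_mult)
  then have "- (pi / 2) < pi * of_int j / real N" "pi * of_int j / real N < pi / 2"
    by linarith+
  then show ?thesis
    unfolding hroot_def cis.sel by (rule cos_gt_zero_pi)
qed

text \<open>With \<open>s = - (r ^ 2 / x ^ 2)\<close> the denominator factors as
  \<open>x ^ 2 * (1 - s * hroot N (2 * j))\<close>. Since \<open>N\<close> is odd,
  \<open>s ^ N\<close> is negative; this yields the plus sign in the final denominator and excludes
  \<open>s ^ N = 1\<close>.\<close>

lemma sum_hroot_over_square_sum:
  fixes r x :: real
  assumes N: "N = 2 * M + 1" and r: "r > 0" and x: "x > 0" and pq: "N dvd p + q" "q < N"
  shows "(\<Sum>j = - int M..int M. hroot N (2 * int p * j) / (of_real x ^ 2 + (of_real r * hroot N j) ^ 2))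
    = of_real (real N * (- (r ^ 2 / x ^ 2)) ^ q * x ^ (2 * N) / x ^ 2 / (x ^ (2 * N) + r ^ (2 * N)))"
proof -
  define s where "s = - (r ^ 2 / x ^ 2)"
  have sN: "s ^ N = - (r ^ (2 * N) / x ^ (2 * N))"
  proof -
    have "odd N" using N by simp
    then show ?thesis by (simp add: s_def power_divide flip: power_mult)
  qed
  have D: "x ^ (2 * N) + r ^ (2 * N) > 0" using r x by (intro add_pos_pos) auto
  have sN': "1 - s ^ N = (x ^ (2 * N) + r ^ (2 * N)) / x ^ (2 * N)"
    unfolding sN using x by (simp add: field_simps)
  have "s ^ N < 0" unfolding sN using r x by simp
  then have "s ^ N \<noteq> 1" by linarith
  then have ne: "complex_of_real s ^ N \<noteq> 1"
    by (metis of_real_eq_1_iff of_real_power)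
  have "hroot N (2 * int p * j) / (of_real x ^ 2 + (of_real r * hroot N j) ^ 2)
      = of_real (1 / x ^ 2) * (hroot N (2 * int p * j) / (1 - of_real s * hroot N (2 * j)))" for j
  proof -
    have "of_real x ^ 2 + (of_real r * hroot N j) ^ 2 = of_real (x ^ 2) * (1 - of_real s * hroot N (2 * j))"
      using x by (simp add: s_def power_mult_distrib hroot_power field_simps)
    then show ?thesis by simp
  qed
  then have "(\<Sum>j = - int M..int M. hroot N (2 * int p * j) / (of_real x ^ 2 + (of_real r * hroot N j) ^ 2))
      = of_real (1 / x ^ 2) * (of_nat N * of_real s ^ q / (1 - of_real s ^ N))"
    using roots_partial_fractions[OF N ne pq] by (simp only: sum_distrib_left[symmetric])
  also have "\<dots> = of_real (1 / x ^ 2 * (real N * s ^ q / (1 - s ^ N)))"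
    by simp
  also have "1 / x ^ 2 * (real N * s ^ q / (1 - s ^ N)) =
      real N * s ^ q * x ^ (2 * N) / x ^ 2 / (x ^ (2 * N) + r ^ (2 * N))"
    unfolding sN' using x D by simp
  finally show ?thesis unfolding s_def .
qed

lemma sum_alternating_hroot_over_square_sum:
  fixes r x :: real
  assumes N: "N = 2 * M + 1" and r: "r > 0" and x: "x > 0"
  shows "(\<Sum>j = - int M..int M. (-1) powi j * hroot N j / (of_real x ^ 2 + (of_real r * hroot N j) ^ 2))
    = of_real (real N * (-1) ^ M * r ^ (N - 1) * (x ^ (N - 1) / (x ^ (2 * N) + r ^ (2 * N))))"
proof -
  have "(M + 1) + M = N" using N by simp
  then have pq: "N dvd (M + 1) + M" "M < N" by auto
  \<comment> \<open>The sign is \<open>hroot N (N * j)\<close>, and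
    \<open>N + 1 = 2 * (M + 1)\<close>; so \<open>p = M + 1\<close>, with complement
    \<open>q = M\<close>.\<close>
  have "(-1) powi j * hroot N j = hroot N (2 * int (M + 1) * j)" for j
  proof -
    have "2 * int (M + 1) * j = int N * j + j" using N by (simp add: algebra_simps)
    moreover have "N > 0" using N by simp
    ultimately show ?thesis by (simp only: hroot_add hroot_multiple)
  qed
  then have "(\<Sum>j = - int M..int M. (-1) powi j * hroot N j / (of_real x ^ 2 + (of_real r * hroot N j) ^ 2))
    = of_real (real N * (- (r ^ 2 / x ^ 2)) ^ M * x ^ (2 * N) / x ^ 2 / (x ^ (2 * N) + r ^ (2 * N)))"
    using sum_hroot_over_square_sum[OF N r x pq] by (simp only:)
  also have "real N * (- (r ^ 2 / x ^ 2)) ^ M * x ^ (2 * N) / x ^ 2 / (x ^ (2 * N) + r ^ (2 * N))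
     = real N * (-1) ^ M * r ^ (N - 1) * (x ^ (N - 1) / (x ^ (2 * N) + r ^ (2 * N)))"
  proof -
    have "(- (r ^ 2 / x ^ 2)) ^ M = (-1) ^ M * r ^ (N - 1) / x ^ (N - 1)"
      unfolding N by (subst power_minus) (simp add: power_divide power_mult)
    moreover have "x ^ (2 * N) = x ^ (N - 1) * x ^ (N - 1) * x ^ 2"
      unfolding N by (simp flip: power_add)
    ultimately have "real N * (- (r ^ 2 / x ^ 2)) ^ M * x ^ (2 * N) / x ^ 2
        = real N * (-1) ^ M * r ^ (N - 1) * x ^ (N - 1)"
      using x by simp
    then show ?thesis by simp
  qed
  finally show ?thesis .
qed

text \<open>At each root the cotangent formula has three parts. The constants leave the alternating
  sum \<open>(-1) ^ M\<close>, the exponentials stay, and the parts \<open>1 / (2 * v ^ 2)\<close>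
  add up to a multiple of the sum of \<open>hroot N (2 * M * j)\<close>, which vanishes unless
  \<open>N dvd M\<close>, that is, unless \<open>N = 1\<close>.\<close>

lemma sums_power_over_power_sum:
  fixes r :: real
  assumes N: "N = 2 * M + 1" and r: "r > 0"
  shows "(\<lambda>n. complex_of_real (real (Suc n) ^ (N - 1) / (real (Suc n) ^ (2 * N) + r ^ (2 * N)))) sums
    (of_real (pi / (real N * r ^ N)) * (1 / 2 + (-1) ^ M *
      (\<Sum>j = - int M..int M. (-1) powi j / (exp (2 * of_real pi * (of_real r * hroot N j)) - 1)))
     - of_real (if N = 1 then 1 / (2 * r ^ 2) else 0))"
proof -
  let ?J = "{- int M..int M}"
  let ?v = "\<lambda>j. of_real r * hroot N j"
  let ?E = "\<lambda>j. exp (2 * of_real pi * ?v j) - 1"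
  define q where "q = complex_of_real (real N * (-1) ^ M * r ^ (N - 1))"
  have "N > 0" using N by simp
  then have q0: "q \<noteq> 0" using r by (simp add: q_def)
  have v: "Re (?v j) > 0" if "j \<in> ?J" for j
    using hroot_Re_pos[OF N that] r by simp
  have "(\<lambda>n. \<Sum>j\<in>?J. (-1) powi j * hroot N j * (1 / (of_nat (Suc n) ^ 2 + ?v j ^ 2))) sums
      (\<Sum>j\<in>?J. (-1) powi j * hroot N j * (of_real pi / (2 * ?v j) * (1 + 2 / ?E j) - 1 / (2 * ?v j ^ 2)))"
    by (intro sums_sum sums_mult sums_coth v)
  then have "(\<lambda>n. q * of_real (real (Suc n) ^ (N - 1) / (real (Suc n) ^ (2 * N) + r ^ (2 * N)))) sums
      (\<Sum>j\<in>?J. (-1) powi j * hroot N j * (of_real pi / (2 * ?v j) * (1 + 2 / ?E j) - 1 / (2 * ?v j ^ 2)))"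
    using sum_alternating_hroot_over_square_sum[OF N r, of "real (Suc n)" for n]
    by (simp add: q_def del: of_nat_Suc)
  then have "(\<lambda>n. of_real (real (Suc n) ^ (N - 1) / (real (Suc n) ^ (2 * N) + r ^ (2 * N)))) sums
      ((\<Sum>j\<in>?J. (-1) powi j * hroot N j * (of_real pi / (2 * ?v j) * (1 + 2 / ?E j) - 1 / (2 * ?v j ^ 2))) / q)"
    by (rule sums_mult_D) (rule q0)
  moreover have "(\<Sum>j\<in>?J. (-1) powi j * hroot N j * (of_real pi / (2 * ?v j) * (1 + 2 / ?E j) - 1 / (2 * ?v j ^ 2)))
     = of_real (pi / (2 * r)) * (-1) ^ M + of_real (pi / r) * (\<Sum>j\<in>?J. (-1) powi j / ?E j)
       - of_real (if N = 1 then 1 / (2 * r ^ 2) else 0)"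
  proof -
    have "(-1) powi j * hroot N j * (of_real pi / (2 * ?v j) * (1 + 2 / ?E j) - 1 / (2 * ?v j ^ 2))
       = of_real (pi / (2 * r)) * (-1) powi j + of_real (pi / r) * ((-1) powi j / ?E j)
         - of_real (1 / (2 * r ^ 2)) * hroot N (2 * int M * j)" for j
    proof -
      have "(-1) powi j = hroot N (2 * int M * j + j)"
        using hroot_multiple[of N j] N by (simp add: algebra_simps)
      then have "(-1) powi j / hroot N j = hroot N (2 * int M * j)"
        by (simp add: hroot_add)
      moreover have "s * z * (p / (2 * (r * z)) * (1 + 2 * e) - 1 / (2 * (r * z) ^ 2))
         = (p / (2 * r)) * s + p / r * (s * e) - 1 / (2 * r ^ 2) * (s / z)"
        if "z \<noteq> 0" "r \<noteq> 0" for s z p r e :: complex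
        using that by (simp add: divide_simps power2_eq_square) (simp add: algebra_simps)
      from this[of "hroot N j" "of_real r" "(-1) powi j" "of_real pi" "1 / ?E j"] r
      have "(-1) powi j * hroot N j * (of_real pi / (2 * ?v j) * (1 + 2 * (1 / ?E j)) - 1 / (2 * ?v j ^ 2))
         = (of_real pi / (2 * of_real r)) * (-1) powi j + of_real pi / of_real r * ((-1) powi j * (1 / ?E j))
          - 1 / (2 * of_real r ^ 2) * ((-1) powi j / hroot N j)"
        by simp
      ultimately show ?thesis by simp
    qed
    then have "(\<Sum>j\<in>?J. (-1) powi j * hroot N j * (of_real pi / (2 * ?v j) * (1 + 2 / ?E j) - 1 / (2 * ?v j ^ 2)))
       = of_real (pi / (2 * r)) * (\<Sum>j\<in>?J. (-1) powi j) + of_real (pi / r) * (\<Sum>j\<in>?J. (-1) powi j / ?E j)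
         - of_real (1 / (2 * r ^ 2)) * (\<Sum>j\<in>?J. hroot N (2 * int M * j))"
      by (simp only: sum.distrib sum_subtractf sum_distrib_left)
    moreover have "N dvd M \<longleftrightarrow> N = 1"
      using N by (auto dest: dvd_imp_le)
    ultimately show ?thesis
      unfolding sum_alternating hroot_sum[OF N] by simp
  qed
  moreover have "(of_real (pi / (2 * r)) * (-1) ^ M + of_real (pi / r) * S - of_real (if N = 1 then 1 / (2 * r ^ 2) else 0)) / q
     = of_real (pi / (real N * r ^ N)) * (1 / 2 + (-1) ^ M * S) - of_real (if N = 1 then 1 / (2 * r ^ 2) else 0)" for S
  proof -
    have q: "q = of_nat N * (-1) ^ M * of_real r ^ (N - 1)" by (simp add: q_def)
    have rN: "complex_of_real r ^ N = of_real r * of_real r ^ (N - 1)"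
      using N by simp
    have "complex_of_real pi / (2 * of_real r) * (-1) ^ M / q = of_real (pi / (real N * r ^ N)) * (1 / 2)"
      unfolding q of_real_divide of_real_mult of_real_power rN by (cases "even M") auto
    moreover have "complex_of_real pi / of_real r * S / q = of_real (pi / (real N * r ^ N)) * ((-1) ^ M * S)"
      unfolding q of_real_divide of_real_mult of_real_power rN by (cases "even M") auto
    \<comment> \<open>For \<open>N = 1\<close> the factor \<open>q\<close> is 1, so the correction
      survives the division unchanged.\<close>
    moreover have "(if N = 1 then 1 / (2 * r ^ 2) else 0) / q = of_real (if N = 1 then 1 / (2 * r ^ 2) else 0)"
      using N by (simp add: q)
    ultimately show ?thesis
      by (simp only: diff_divide_distrib add_divide_distrib distrib_left of_real_divide of_real_mult of_real_numeral)
  qed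
  ultimately show ?thesis by (simp only:)
qed

text \<open>The root sum with \<open>p = q = 0\<close>: averaging the Digamma pairs over the
  \<open>N\<close> roots keeps 1/n, and with it Euler's constant, at weight one.\<close>

lemma sums_Digamma_power_sum:
  fixes r :: real
  assumes N: "N = 2 * M + 1" and r: "r > 0"
  shows "(\<lambda>n. complex_of_real (1 / real (Suc n) - real (Suc n) ^ (2 * N - 1) / (real (Suc n) ^ (2 * N) + r ^ (2 * N)))) sums
    (euler_mascheroni + 1 / (2 * of_nat N) * (\<Sum>j = - int M..int M.
      Digamma (\<i> * (of_real r * hroot N j)) + Digamma (- \<i> * (of_real r * hroot N j))))"
proof -
  let ?J = "{- int M..int M}"
  let ?v = "\<lambda>j. of_real r * hroot N j"
  have v: "Re (?v j) > 0" if "j \<in> ?J" for j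
    using hroot_Re_pos[OF N that] r by simp
  have card: "card ?J = N" using N by simp
  have "N > 0" using N by simp
  then have N0: "complex_of_nat N \<noteq> 0" by simp
  have "(\<lambda>n. 1 / of_nat N * (\<Sum>j\<in>?J. 1 / of_nat (Suc n) - of_nat (Suc n) / (of_nat (Suc n) ^ 2 + ?v j ^ 2))) sums
      (1 / of_nat N * (\<Sum>j\<in>?J. euler_mascheroni + (Digamma (\<i> * ?v j) + Digamma (- \<i> * ?v j)) / 2))"
    by (intro sums_mult sums_sum sums_Digamma_pair v)
  moreover have "1 / of_nat N * (\<Sum>j\<in>?J. 1 / of_nat (Suc n) - of_nat (Suc n) / (of_nat (Suc n) ^ 2 + ?v j ^ 2))
      = complex_of_real (1 / real (Suc n) - real (Suc n) ^ (2 * N - 1) / (real (Suc n) ^ (2 * N) + r ^ (2 * N)))" for n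
  proof -
    let ?x = "real (Suc n)"
    have "(\<Sum>j\<in>?J. 1 / of_nat (Suc n) - of_nat (Suc n) / (of_nat (Suc n) ^ 2 + ?v j ^ 2))
        = of_nat N / of_nat (Suc n) - of_nat (Suc n) * (\<Sum>j\<in>?J. hroot N (2 * int 0 * j) / (of_real ?x ^ 2 + ?v j ^ 2))"
      unfolding sum_subtractf sum_distrib_left sum_constant card by (simp add: hroot_def del: of_nat_Suc)
    also have "\<dots> = of_nat N / of_nat (Suc n) - of_nat (Suc n) *
        of_real (real N * x ^ (2 * N) / x ^ 2 / (x ^ (2 * N) + r ^ (2 * N)))" if "x = ?x" for x
      using sum_hroot_over_square_sum[OF N r, of ?x 0 0] N that by simp
    finally have "1 / of_nat N * (\<Sum>j\<in>?J. 1 / of_nat (Suc n) - of_nat (Suc n) / (of_nat (Suc n) ^ 2 + ?v j ^ 2))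
      = of_real (1 / real N * (real N / ?x - ?x * (real N * ?x ^ (2 * N) / ?x ^ 2 / (?x ^ (2 * N) + r ^ (2 * N)))))"
      by simp
    also have "1 / real N * (real N / ?x - ?x * (real N * ?x ^ (2 * N) / ?x ^ 2 / (?x ^ (2 * N) + r ^ (2 * N))))
       = 1 / ?x - ?x ^ (2 * N - 1) / (?x ^ (2 * N) + r ^ (2 * N))"
    proof -
      have "?x ^ (2 * N) = ?x ^ (2 * N - 1) * ?x"
        using N by (simp flip: power_Suc2)
      then have "?x * (real N * ?x ^ (2 * N) / ?x ^ 2 / d) = real N * (?x ^ (2 * N - 1) / d)" for d
        by (simp add: power2_eq_square)
      then show ?thesis using N0 by (simp add: right_diff_distrib)
    qed
    finally show ?thesis .
  qed
  moreover have "1 / of_nat N * (\<Sum>j\<in>?J. euler_mascheroni + (Digamma (\<i> * ?v j) + Digamma (- \<i> * ?v j)) / 2)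
      = euler_mascheroni + 1 / (2 * of_nat N) * (\<Sum>j\<in>?J. Digamma (\<i> * ?v j) + Digamma (- \<i> * ?v j))"
  proof -
    have "1 / of_nat N * (\<Sum>j\<in>?J. euler_mascheroni + f j / 2) = euler_mascheroni + 1 / (2 * of_nat N) * (\<Sum>j\<in>?J. f j)"
      for f :: "int \<Rightarrow> complex"
    proof -
      have "(\<Sum>j\<in>?J. euler_mascheroni + f j / 2) = of_nat N * euler_mascheroni + (\<Sum>j\<in>?J. f j) / 2"
        by (simp only: sum.distrib sum_constant card sum_divide_distrib)
      then show ?thesis using N0 by (simp add: field_simps)
    qed
    then show ?thesis .
  qed
  ultimately show ?thesis by (simp only:)
qed

text \<open>Bounds the growth of the Digamma terms in r, uniformly in n: for v = r z with |z| = 1,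
  |n^2 + v^2| = n r |n / (r z) + r z / n| is at least 2 n r Re z.\<close>
lemma Digamma_pair_bound:
  fixes r :: real
  assumes r: "r > 0" and z: "Re z > 0" "norm z = 1"
  shows "norm (euler_mascheroni + (Digamma (\<i> * (of_real r * z)) + Digamma (- \<i> * (of_real r * z))) / 2)
    \<le> r * ((\<Sum>n. 1 / real (Suc n) ^ 2) / (2 * Re z))"
proof -
  let ?v = "of_real r * z"
  have v: "Re ?v > 0" using r z by simp
  note S = sums_Digamma_pair[OF v]
  have bound: "norm (1 / of_nat (Suc n) - of_nat (Suc n) / (of_nat (Suc n) ^ 2 + ?v ^ 2))
      \<le> r / (2 * Re z) * (1 / real (Suc n) ^ 2)" for n
  proof -
    let ?x = "real (Suc n)"
    have "2 * ?x * r * Re z \<le> (?x ^ 2 + r ^ 2) * Re z"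
      using sum_squares_bound[of ?x r] z by (intro mult_right_mono) auto
    also have "\<dots> = Re ((of_real ?x ^ 2 + ?v ^ 2) * cnj z)"
    proof -
      have "z * cnj z = 1" using z(2) by (simp add: complex_norm_square[symmetric])
      moreover have "?v ^ 2 * cnj z = of_real (r ^ 2) * z * (z * cnj z)"
        by (simp add: power2_eq_square mult_ac)
      ultimately have E: "(of_real ?x ^ 2 + ?v ^ 2) * cnj z = of_real (?x ^ 2) * cnj z + of_real (r ^ 2) * z"
        by (simp add: distrib_right del: of_nat_Suc)
      show ?thesis
        unfolding E by (simp add: distrib_right)
    qed
    also have "\<dots> \<le> norm (of_real ?x ^ 2 + ?v ^ 2)"
      using complex_Re_le_cmod[of "(of_real ?x ^ 2 + ?v ^ 2) * cnj z"] z(2) by (simp add: norm_mult)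
    finally have D: "2 * ?x * r * Re z \<le> norm (of_real ?x ^ 2 + ?v ^ 2)" .
    have "1 / of_real ?x - of_real ?x / (of_real ?x ^ 2 + ?v ^ 2) = ?v ^ 2 / (of_real ?x * (of_real ?x ^ 2 + ?v ^ 2))"
      using square_sum_factor(4)[OF v, of ?x] by (simp add: divide_simps power2_eq_square del: of_nat_Suc)
    then have "norm (1 / of_real ?x - of_real ?x / (of_real ?x ^ 2 + ?v ^ 2))
        = r ^ 2 / (?x * norm (of_real ?x ^ 2 + ?v ^ 2))"
      using r z(2) by (simp add: norm_divide norm_mult norm_power del: of_nat_Suc)
    also have "\<dots> \<le> r ^ 2 / (?x * (2 * ?x * r * Re z))"
    proof -
      have pos: "0 < 2 * ?x * r * Re z" using r z by (intro mult_pos_pos) auto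
      show ?thesis
        using less_le_trans[OF pos D] pos r z by (intro divide_left_mono mult_left_mono D mult_pos_pos) auto
    qed
    also have "\<dots> = r / (2 * Re z) * (1 / ?x ^ 2)"
      using r z by (simp add: power2_eq_square del: of_nat_Suc)
    finally show ?thesis by simp
  qed
  have "summable (\<lambda>n. 1 / real (Suc n) ^ 2)"
    using inverse_power_summable[of 2, where 'a = real]
    by (subst summable_Suc_iff[of "\<lambda>k. 1 / real k ^ 2"]) (simp add: field_simps)
  from summable_sums[OF this] have P: "(\<lambda>n. r / (2 * Re z) * (1 / real (Suc n) ^ 2)) sums
      (r / (2 * Re z) * (\<Sum>n. 1 / real (Suc n) ^ 2))"
    by (rule sums_mult)
  show ?thesis
    using norm_sums_le[OF S P bound] by simp
qed

section \<open>The double series and its interchange\<close>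

text \<open>The product majorant makes the double family absolutely summable, so both iterated sums
  equal its total. Convergence of the outer series belongs to the conclusion, hence the existential
  form.\<close>

lemma sums_swap_product_bound:
  fixes K :: "nat \<Rightarrow> nat \<Rightarrow> real"
  assumes bound: "\<And>n k. \<bar>K n k\<bar> \<le> P n * Q k"
    and P: "summable P" "\<And>n. P n \<ge> 0" and Q: "summable Q" "\<And>k. Q k \<ge> 0"
    and rows: "\<And>n. K n sums R n" and cols: "\<And>k. (\<lambda>n. K n k) sums C k"
  shows "\<exists>S. R sums S \<and> C sums S"
proof -
  have Qsum: "(Q has_sum suminf Q) UNIV"
    using Q by (intro norm_summable_imp_has_sum summable_sums) simp_all
  have "(\<lambda>(n, k). P n * Q k) summable_on UNIV \<times> UNIV"
  proof (rule summable_on_SigmaI)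
    fix n :: nat
    show "((\<lambda>k. case (n, k) of (n, k) \<Rightarrow> P n * Q k) has_sum P n * suminf Q) UNIV"
      using has_sum_cmult_right[OF Qsum, of "P n"] by simp
  next
    show "(\<lambda>n. P n * suminf Q) summable_on UNIV"
      using P by (intro summable_on_cmult_left norm_summable_imp_summable_on) simp
  qed (use P Q in auto)
  then have "(\<lambda>p. norm (case p of (n, k) \<Rightarrow> K n k)) summable_on UNIV \<times> UNIV"
    by (rule Infinite_Sum.abs_summable_on_comparison_test') (use bound in auto)
  then have "(\<lambda>(n, k). K n k) summable_on UNIV \<times> UNIV"
    by (rule abs_summable_summable)
  then obtain S where S: "((\<lambda>(n, k). K n k) has_sum S) (UNIV \<times> UNIV)"
    by (auto simp: summable_on_def)
  have "(K n has_sum R n) UNIV" for n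
  proof (rule norm_summable_imp_has_sum[OF _ rows])
    show "summable (\<lambda>k. norm (K n k))"
      by (rule summable_comparison_test'[OF summable_mult[OF Q(1), of "P n"]]) (use bound in auto)
  qed
  then have R: "(R has_sum S) UNIV"
    using has_sum_SigmaD[OF S, of R] by simp
  have "((\<lambda>n. K n k) has_sum C k) UNIV" for k
  proof (rule norm_summable_imp_has_sum[OF _ cols])
    show "summable (\<lambda>n. norm (K n k))"
      by (rule summable_comparison_test'[OF summable_mult2[OF P(1), of "Q k"]]) (use bound in auto)
  qed
  then have C: "(C has_sum S) UNIV"
    using has_sum_SigmaD[OF has_sum_swap[THEN iffD1, OF S], of C] by simp
  show ?thesis using R C has_sum_imp_sums by blast
qed

lemma summable_inverse_Suc_power:
  "p \<ge> 2 \<Longrightarrow> summable (\<lambda>n. 1 / real (Suc n) ^ p)"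
  using inverse_power_summable[of p, where 'a = real]
  by (subst summable_Suc_iff[of "\<lambda>k. 1 / real k ^ p"]) (simp add: field_simps)

lemma sums_zeta: "p \<ge> 2 \<Longrightarrow> (\<lambda>n. 1 / real (Suc n) ^ p) sums zeta (real p)"
  using summable_sums[OF summable_inverse_Suc_power]
  by (simp add: zeta_def powr_realpow)

lemma zeta_even:
  assumes "l > 0"
  shows "zeta (real (2 * l)) = (-1) ^ (l + 1) * (2 * pi) ^ (2 * l) * bern_norm (2 * l) 1 / 2"
proof -
  have "cos (2 * pi * real (Suc k) * 1) = 1" for k
    using cos_int_2pin[of "int (Suc k)"] by simp
  then have eq: "2 * (-1) ^ (l + 1) * cos (2 * pi * real (Suc k) * 1) / (2 * pi * real (Suc k)) ^ (2 * l)
      = 2 * (-1) ^ (l + 1) / (2 * pi) ^ (2 * l) * (1 / real (Suc k) ^ (2 * l))" for k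
    by (simp only: power_mult_distrib) simp
  have "(\<lambda>k. 2 * (-1) ^ (l + 1) / (2 * pi) ^ (2 * l) * (1 / real (Suc k) ^ (2 * l))) sums bern_norm (2 * l) 1"
    using bern_norm_even_Fourier[OF assms, of 1] unfolding eq by simp
  moreover have "(\<lambda>k. 2 * (-1) ^ (l + 1) / (2 * pi) ^ (2 * l) * (1 / real (Suc k) ^ (2 * l))) sums
      (2 * (-1) ^ (l + 1) / (2 * pi) ^ (2 * l) * zeta (real (2 * l)))"
    using assms by (intro sums_mult sums_zeta) simp
  ultimately have "bern_norm (2 * l) 1 = 2 * (-1) ^ (l + 1) / (2 * pi) ^ (2 * l) * zeta (real (2 * l))"
    by (rule sums_unique2)
  then show ?thesis by (cases "even l") simp_all
qed

text \<open>The constant 3 comes from \<open>2 * t * c \<le> t ^ 2 + c ^ 2\<close>. The bound is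
  uniform in \<open>c\<close>: decay in the Fourier index is left to the factor (t /
  c)^(2m).\<close>

lemma quadratic_denominator_bound:
  fixes t c :: real
  assumes "t > 0" "c > 0" "\<bar>u\<bar> \<le> 1" "\<bar>v\<bar> \<le> 1"
  shows "\<bar>(2 * t * u + 2 * c * v) / (t ^ 2 + c ^ 2)\<bar> \<le> 3 / t"
proof -
  have D: "t ^ 2 + c ^ 2 > 0" using assms by (simp add: add_pos_pos)
  have "\<bar>2 * t * u\<bar> \<le> 2 * t * 1" "\<bar>2 * c * v\<bar> \<le> 2 * c * 1"
    unfolding abs_mult using assms by (auto intro!: mult_left_mono)
  then have "\<bar>2 * t * u + 2 * c * v\<bar> \<le> 2 * t + 2 * c" by linarith
  moreover have "(2 * t + 2 * c) * t \<le> 3 * (t ^ 2 + c ^ 2)"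
  proof -
    have "(2 * t + 2 * c) * t = 2 * t ^ 2 + 2 * t * c" by (simp add: power2_eq_square algebra_simps)
    then show ?thesis
      using sum_squares_bound[of t c] zero_le_power2[of c] unfolding distrib_left by linarith
  qed
  then have "(2 * t + 2 * c) / (t ^ 2 + c ^ 2) \<le> 3 / t"
    using D assms by (simp add: field_simps)
  ultimately show ?thesis
    using D by (simp add: abs_divide) (meson divide_right_mono less_imp_le order_trans)
qed

lemma bern_sum_split:
  "(\<Sum>j=1..2*m. (-1) ^ j * bern_norm j a * t ^ (j - 1)) =
    (\<Sum>i=1..m. bern_norm (2 * i) a * t ^ (2 * i - 1)) - (\<Sum>i<m. bern_norm (2 * i + 1) a * t ^ (2 * i))" for m
proof (induction m)
  case (Suc m)
  have "(\<Sum>j=1..2*Suc m. (-1) ^ j * bern_norm j a * t ^ (j - 1)) =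
    (\<Sum>j=1..2*m. (-1) ^ j * bern_norm j a * t ^ (j - 1)) - bern_norm (2 * m + 1) a * t ^ (2 * m)
     + bern_norm (2 * Suc m) a * t ^ (2 * Suc m - 1)"
    by simp
  then show ?case using Suc by simp
qed simp

section \<open>The Lambert series, its Taylor part and its remainder\<close>

text \<open>\<open>r k\<close> is the radius for which (n^N y)^2 + (2 pi (k + 1))^2 equals y^2
  (n^(2N) + r_k^(2N)). It is characterized by its N-th power, so that fractional exponents enter
  only in the final theorem, where \<open>y\<close> is \<open>2 ^ N * \<alpha>\<close>.\<close>

locale lambert_data =
  fixes N M m :: nat and y a :: real and r :: "nat \<Rightarrow> real"
  assumes N: "N = 2 * M + 1" and m: "m > 0" and y: "y > 0" and a: "a \<in> {0..1}"
    and r: "\<And>k. r k > 0" and rN: "\<And>k. r k ^ N = 2 * pi * real (Suc k) / y"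
begin

lemma N_pos: "N > 0"
  using N by simp

lemma r_lower: "r 0 \<le> r k"
proof (rule power_le_imp_le_base)
  have "1 \<le> real (Suc k)" by simp
  then have "r 0 ^ N \<le> r k ^ N"
    unfolding rN using y by (intro divide_right_mono mult_left_mono) auto
  then show "r 0 ^ Suc (2 * M) \<le> r k ^ Suc (2 * M)" using N by simp
qed (use r[of k] in simp)

text \<open>Linear growth is coarse but suffices for the Digamma terms; the preceding lower bound
  serves the exponential ones.\<close>

lemma r_upper: "r k \<le> r 0 * real (Suc k)"
proof (rule power_le_imp_le_base)
  have "real (Suc k) ^ 1 \<le> real (Suc k) ^ N"
    using N_pos by (intro power_increasing) auto
  then have "2 * pi / y * real (Suc k) \<le> 2 * pi / y * real (Suc k) ^ N"
    using y by (intro mult_left_mono) auto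
  then have "r k ^ N \<le> (r 0 * real (Suc k)) ^ N"
    unfolding power_mult_distrib rN by simp
  then show "r k ^ Suc (2 * M) \<le> (r 0 * real (Suc k)) ^ Suc (2 * M)" using N by simp
qed (use r[of 0] in simp)

text \<open>The weight x^(-2Nm-1) meets x^(2Nm) from the kernel, so only 1/x is left and
  \<open>m\<close> drops out of the sums over n. In the sine part, 1/x over the denominator splits
  into the difference that sums to Digamma values.\<close>

lemma kernel_split:
  fixes x c R u v :: real
  assumes x: "x > 0" and c: "c > 0" and R: "R > 0" "R ^ N = c / y"
  shows "1 / x ^ (2 * N * m + 1) * ((-1) ^ m * (x ^ N * y / c) ^ (2 * m) *
      (2 * (x ^ N * y) * u + 2 * c * v) / ((x ^ N * y) ^ 2 + c ^ 2))
    = (-1) ^ m * (y / c) ^ (2 * m) *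
      (2 / y * u * (x ^ (N - 1) / (x ^ (2 * N) + R ^ (2 * N))) +
       2 / c * v * (1 / x - x ^ (2 * N - 1) / (x ^ (2 * N) + R ^ (2 * N))))"
proof -
  define X where "X = x ^ (N - 1)"
  define D where "D = x ^ (2 * N) + R ^ (2 * N)"
  have D: "D > 0" using x R by (simp add: D_def add_pos_pos)
  have xN: "x ^ N = X * x" using N_pos by (simp add: X_def power_eq_if)
  have x2N: "x ^ (2 * N) = x ^ N * x ^ N" by (simp add: mult_2 power_add)
  have x2N1: "x ^ (2 * N - 1) = x ^ N * X"
    using N_pos by (simp add: X_def mult_2 flip: power_add)
  have R2N: "R ^ (2 * N) = c ^ 2 / y ^ 2"
    using R(2) by (simp add: mult.commute[of 2] power_mult power_divide)
  have den: "(x ^ N * y) ^ 2 + c ^ 2 = y ^ 2 * D"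
    unfolding D_def x2N R2N distrib_left using y by (simp add: power2_eq_square mult_ac)
  have Bk: "1 / x - x ^ (2 * N - 1) / D = c ^ 2 / (y ^ 2 * x * D)"
  proof -
    have "1 / x - x ^ (2 * N - 1) / D = (D - x ^ (2 * N - 1) * x) / (x * D)"
      using x D by (simp add: diff_divide_distrib)
    also have "x ^ (2 * N - 1) * x = x ^ (2 * N)"
      using N_pos by (simp flip: power_Suc2)
    also have "D - x ^ (2 * N) = c ^ 2 / y ^ 2" by (simp add: D_def R2N)
    finally show ?thesis using y by simp
  qed
  have pw: "1 / x ^ (2 * N * m + 1) * (x ^ N * y / c) ^ (2 * m) = (y / c) ^ (2 * m) / x"
  proof -
    have "(x ^ N * y / c) ^ (2 * m) = x ^ (2 * N * m) * (y / c) ^ (2 * m)"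
      by (simp add: power_mult_distrib power_divide mult_ac flip: power_mult)
    then show ?thesis using x by simp
  qed
  have "1 / x ^ (2 * N * m + 1) * ((-1) ^ m * (x ^ N * y / c) ^ (2 * m) *
      (2 * (x ^ N * y) * u + 2 * c * v) / ((x ^ N * y) ^ 2 + c ^ 2))
    = (-1) ^ m * (1 / x ^ (2 * N * m + 1) * (x ^ N * y / c) ^ (2 * m)) *
      ((2 * (x ^ N * y) * u + 2 * c * v) / (y ^ 2 * D))"
    unfolding den by simp
  also have "\<dots> = (-1) ^ m * (y / c) ^ (2 * m) * ((2 * (x ^ N * y) * u + 2 * c * v) / (x * (y ^ 2 * D)))"
    unfolding pw by simp
  also have "(2 * (x ^ N * y) * u + 2 * c * v) / (x * (y ^ 2 * D))
      = 2 / y * u * (X / D) + 2 / c * v * (c ^ 2 / (y ^ 2 * x * D))"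
  proof -
    have "2 * (X * x * y) * u / (x * (y ^ 2 * D)) = 2 / y * u * (X / D)"
      using x y by (simp add: power2_eq_square)
    moreover have "2 * c * v / (x * (y ^ 2 * D)) = 2 / c * v * (c ^ 2 / (y ^ 2 * x * D))"
      using c by (simp add: power2_eq_square mult_ac)
    ultimately show ?thesis unfolding xN add_divide_distrib by (simp only:)
  qed
  finally show ?thesis
    unfolding X_def[symmetric] D_def[symmetric] Bk .
qed

definition lam_term :: "nat \<Rightarrow> real" where
  "lam_term n = 1 / real (Suc n) ^ (2 * N * m + 1) *
    (exp (- a * (real (Suc n) ^ N * y)) / (1 - exp (- (real (Suc n) ^ N * y))))"

definition remainder_sum :: real where
  "remainder_sum = (\<Sum>n. 1 / real (Suc n) ^ (2 * N * m + 1) *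
    (exp (- a * (real (Suc n) ^ N * y)) / (1 - exp (- (real (Suc n) ^ N * y))) - 1 / (real (Suc n) ^ N * y)
      - (\<Sum>j=1..2*m. (-1) ^ j * bern_norm j a * (real (Suc n) ^ N * y) ^ (j - 1))))"

lemma remainder_swap:
  assumes A: "\<And>k. (\<lambda>n. real (Suc n) ^ (N - 1) / (real (Suc n) ^ (2 * N) + r k ^ (2 * N))) sums A k"
    and B: "\<And>k. (\<lambda>n. 1 / real (Suc n) - real (Suc n) ^ (2 * N - 1) / (real (Suc n) ^ (2 * N) + r k ^ (2 * N))) sums B k"
  shows "(\<lambda>n. 1 / real (Suc n) ^ (2 * N * m + 1) *
    (exp (- a * (real (Suc n) ^ N * y)) / (1 - exp (- (real (Suc n) ^ N * y))) - 1 / (real (Suc n) ^ N * y)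
      - (\<Sum>j=1..2*m. (-1) ^ j * bern_norm j a * (real (Suc n) ^ N * y) ^ (j - 1)))) sums remainder_sum" (is "?R sums _")
    and "(\<lambda>k. (-1) ^ m * (y / (2 * pi * real (Suc k))) ^ (2 * m) *
      (2 / y * cos (2 * pi * real (Suc k) * a) * A k +
       2 / (2 * pi * real (Suc k)) * sin (2 * pi * real (Suc k) * a) * B k)) sums remainder_sum" (is "?C sums _")
proof -
  define c where "c k = 2 * pi * real (Suc k)" for k
  define x where "x n = real (Suc n)" for n
  have c: "c k > 0" for k by (simp add: c_def)
  have x: "x n > 0" for n by (simp add: x_def)
  define K where "K n k = 1 / x n ^ (2 * N * m + 1) * ((-1) ^ m * (x n ^ N * y / c k) ^ (2 * m) *
      (2 * (x n ^ N * y) * cos (c k * a) + 2 * c k * sin (c k * a)) / ((x n ^ N * y) ^ 2 + c k ^ 2))" for n k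
  have K: "K n k = (-1) ^ m * (y / c k) ^ (2 * m) *
      (2 / y * cos (c k * a) * (x n ^ (N - 1) / (x n ^ (2 * N) + r k ^ (2 * N))) +
       2 / c k * sin (c k * a) * (1 / x n - x n ^ (2 * N - 1) / (x n ^ (2 * N) + r k ^ (2 * N))))" for n k
    unfolding K_def by (rule kernel_split[OF x c r]) (simp add: rN c_def)
  have "\<exists>S. ?R sums S \<and> ?C sums S"
  \<comment> \<open>\<open>Q\<close> collects (t / c)^(2m) and 3 / t after \<open>c k\<close> is
    replaced by the smaller \<open>x k\<close>. The exponent then left on \<open>x n\<close> is
    \<open>N + 1\<close>, weakened to 2 in \<open>P\<close>.\<close>
  proof (rule sums_swap_product_bound[where K = K and P = "\<lambda>n. 1 / x n ^ 2" and Q = "\<lambda>k. 3 * y ^ (2 * m) / y * (1 / x k ^ (2 * m))"])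
    show "summable (\<lambda>n. 1 / x n ^ 2)"
      unfolding x_def by (rule summable_inverse_Suc_power) simp
    show "summable (\<lambda>k. 3 * y ^ (2 * m) / y * (1 / x k ^ (2 * m)))"
      unfolding x_def using m by (intro summable_mult summable_inverse_Suc_power) simp
    show "1 / x n ^ 2 \<ge> 0" for n by simp
    show "3 * y ^ (2 * m) / y * (1 / x k ^ (2 * m)) \<ge> 0" for k using y by simp
    show "K n sums ?R n" for n
    proof -
      have t: "x n ^ N * y > 0" using x y by simp
      from sums_mult[OF exp_quotient_expansion[OF t m a], of "1 / x n ^ (2 * N * m + 1)"]
      show ?thesis by (simp only: K_def[abs_def] x_def c_def)
    qed
    show "(\<lambda>n. K n k) sums ?C k" for k
      unfolding K using A[of k] B[of k]
      by (simp only: x_def c_def) (intro sums_mult sums_add)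
    show "\<bar>K n k\<bar> \<le> 1 / x n ^ 2 * (3 * y ^ (2 * m) / y * (1 / x k ^ (2 * m)))" for n k
    proof -
      let ?t = "x n ^ N * y"
      have t: "?t > 0" using x y by simp
      have x1: "1 \<le> x n" by (simp add: x_def)
      have "\<bar>K n k\<bar> = 1 / x n ^ (2 * N * m + 1) * (?t / c k) ^ (2 * m) *
          \<bar>(2 * ?t * cos (c k * a) + 2 * c k * sin (c k * a)) / (?t ^ 2 + c k ^ 2)\<bar>"
        using x[of n] t c[of k] y by (simp add: K_def abs_mult abs_divide power_abs)
      also have "\<dots> \<le> 1 / x n ^ (2 * N * m + 1) * (?t / c k) ^ (2 * m) * (3 / ?t)"
        using x[of n] t c[of k] by (intro mult_left_mono quadratic_denominator_bound) auto
      also have "\<dots> \<le> 1 / x n ^ (2 * N * m + 1) * (?t / x k) ^ (2 * m) * (3 / ?t)"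
      proof (intro mult_right_mono mult_left_mono power_mono divide_left_mono)
        show "x k \<le> c k"
          using mult_right_mono[of 1 "2 * pi" "x k"] pi_gt3 x[of k] by (simp add: c_def x_def)
      qed (use x[of n] x[of k] c[of k] t in auto)
      also have "\<dots> = 1 / x n ^ (N + 1) * (3 * y ^ (2 * m) / y * (1 / x k ^ (2 * m)))"
      proof -
        have "?t ^ (2 * m) = x n ^ (2 * N * m) * y ^ (2 * m)"
          by (simp add: power_mult_distrib mult_ac flip: power_mult)
        then show ?thesis using x[of n] x[of k] y by (simp add: power_divide power_add mult_ac)
      qed
      also have "\<dots> \<le> 1 / x n ^ 2 * (3 * y ^ (2 * m) / y * (1 / x k ^ (2 * m)))"
        using x1 N_pos y x[of k] by (intro mult_right_mono divide_left_mono power_increasing) auto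
      finally show ?thesis .
    qed
  qed
  then obtain S where S: "?R sums S" "?C sums S" by blast
  have "S = remainder_sum"
    unfolding remainder_sum_def using S(1) by (rule sums_unique)
  with S show "?R sums remainder_sum" "?C sums remainder_sum" by simp_all
qed

text \<open>The Taylor terms are added back, the pole 1/t joining the even ones as
  \<open>i = 0\<close>. The odd ones stop before \<open>i = m\<close>, where the exponent of n would
  drop to 1.\<close>

lemma lam_term_sums:
  assumes R: "(\<lambda>n. 1 / real (Suc n) ^ (2 * N * m + 1) *
    (exp (- a * (real (Suc n) ^ N * y)) / (1 - exp (- (real (Suc n) ^ N * y))) - 1 / (real (Suc n) ^ N * y)
      - (\<Sum>j=1..2*m. (-1) ^ j * bern_norm j a * (real (Suc n) ^ N * y) ^ (j - 1)))) sums S"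
  shows "lam_term sums (S + (\<Sum>i\<le>m. bern_norm (2 * i) a * y ^ (2 * i) / y * zeta (real (N + 1 + 2 * N * (m - i))))
    - (\<Sum>i<m. bern_norm (2 * i + 1) a * y ^ (2 * i) * zeta (real (2 * N * (m - i) + 1))))"
proof -
  have "(\<lambda>n. 1 / real (Suc n) ^ (2 * N * m + 1) *
    (exp (- a * (real (Suc n) ^ N * y)) / (1 - exp (- (real (Suc n) ^ N * y))) - 1 / (real (Suc n) ^ N * y)
      - (\<Sum>j=1..2*m. (-1) ^ j * bern_norm j a * (real (Suc n) ^ N * y) ^ (j - 1)))
    + (\<Sum>i\<le>m. bern_norm (2 * i) a * y ^ (2 * i) / y * (1 / real (Suc n) ^ (N + 1 + 2 * N * (m - i))))
    - (\<Sum>i<m. bern_norm (2 * i + 1) a * y ^ (2 * i) * (1 / real (Suc n) ^ (2 * N * (m - i) + 1)))) sums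
   (S + (\<Sum>i\<le>m. bern_norm (2 * i) a * y ^ (2 * i) / y * zeta (real (N + 1 + 2 * N * (m - i))))
    - (\<Sum>i<m. bern_norm (2 * i + 1) a * y ^ (2 * i) * zeta (real (2 * N * (m - i) + 1))))"
  proof (intro sums_add sums_diff R sums_sum sums_mult sums_zeta)
    fix i assume "i \<in> {..<m}"
    then show "2 \<le> 2 * N * (m - i) + 1" using N_pos by (cases "N * (m - i)") auto
  qed (use N_pos in auto)
  moreover have "1 / x ^ (2 * N * m + 1) *
    (f - 1 / (x ^ N * y) - (\<Sum>j=1..2*m. (-1) ^ j * bern_norm j a * (x ^ N * y) ^ (j - 1)))
    + (\<Sum>i\<le>m. bern_norm (2 * i) a * y ^ (2 * i) / y * (1 / x ^ (N + 1 + 2 * N * (m - i))))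
    - (\<Sum>i<m. bern_norm (2 * i + 1) a * y ^ (2 * i) * (1 / x ^ (2 * N * (m - i) + 1)))
    = 1 / x ^ (2 * N * m + 1) * f" if x: "x > 0" for x f :: real
  proof -
    let ?t = "x ^ N * y"
    have t: "?t \<noteq> 0" using x y by simp
    have e: "1 / x ^ (2 * N * m + 1) * (x ^ N) ^ (2 * i) = 1 / x ^ (2 * N * (m - i) + 1)" if "i \<le> m" for i
    proof -
      have "2 * N * m + 1 = 2 * N * (m - i) + 1 + N * (2 * i)"
      proof -
        have "2 * N * m = 2 * N * ((m - i) + i)" using that by simp
        then show ?thesis unfolding distrib_left by simp
      qed
      then have "x ^ (2 * N * m + 1) = x ^ (2 * N * (m - i) + 1) * (x ^ N) ^ (2 * i)"
        by (simp only: power_add power_mult)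
      then show ?thesis using x by simp
    qed
    have even: "bern_norm (2 * i) a * y ^ (2 * i) / y * (1 / x ^ (N + 1 + 2 * N * (m - i)))
        = 1 / x ^ (2 * N * m + 1) * (bern_norm (2 * i) a * (?t ^ (2 * i) / ?t))" if "i \<le> m" for i
    proof -
      have "1 / x ^ (2 * N * m + 1) * (bern_norm (2 * i) a * (?t ^ (2 * i) / ?t))
          = bern_norm (2 * i) a * y ^ (2 * i) / y * (1 / x ^ (2 * N * m + 1) * (x ^ N) ^ (2 * i)) / x ^ N"
        by (simp add: power_mult_distrib mult_ac)
      also have "\<dots> = bern_norm (2 * i) a * y ^ (2 * i) / y * (1 / x ^ (N + 1 + 2 * N * (m - i)))"
        unfolding e[OF that] by (simp add: power_add mult_ac)
      finally show ?thesis by simp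
    qed
    have odd: "bern_norm (2 * i + 1) a * y ^ (2 * i) * (1 / x ^ (2 * N * (m - i) + 1))
        = 1 / x ^ (2 * N * m + 1) * (bern_norm (2 * i + 1) a * ?t ^ (2 * i))" if "i < m" for i
      using that unfolding e[OF less_imp_le[OF that], symmetric] by (simp add: power_mult_distrib)
    have "(\<Sum>i\<le>m. bern_norm (2 * i) a * y ^ (2 * i) / y * (1 / x ^ (N + 1 + 2 * N * (m - i))))
        = 1 / x ^ (2 * N * m + 1) * (\<Sum>i\<le>m. bern_norm (2 * i) a * (?t ^ (2 * i) / ?t))"
      unfolding sum_distrib_left by (rule sum.cong) (use even in auto)
    \<comment> \<open>The quotient form matters at \<open>i = 0\<close>: there the truncated
      exponent \<open>2 * i - 1\<close> would be 0 instead of -1.\<close>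
    also have "(\<Sum>i\<le>m. bern_norm (2 * i) a * (?t ^ (2 * i) / ?t))
        = 1 / ?t + (\<Sum>i=1..m. bern_norm (2 * i) a * ?t ^ (2 * i - 1))"
    proof -
      have "(\<Sum>i\<le>m. bern_norm (2 * i) a * (?t ^ (2 * i) / ?t))
          = 1 / ?t + (\<Sum>i=1..m. bern_norm (2 * i) a * (?t ^ (2 * i) / ?t))"
        by (simp add: atMost_atLeast0 sum.atLeast_Suc_atMost bern_norm_0)
      also have "(\<Sum>i=1..m. bern_norm (2 * i) a * (?t ^ (2 * i) / ?t)) = (\<Sum>i=1..m. bern_norm (2 * i) a * ?t ^ (2 * i - 1))"
        using t by (intro sum.cong) (auto simp: power_diff)
      finally show ?thesis .
    qed
    finally have E: "(\<Sum>i\<le>m. bern_norm (2 * i) a * y ^ (2 * i) / y * (1 / x ^ (N + 1 + 2 * N * (m - i))))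
        = 1 / x ^ (2 * N * m + 1) * (1 / ?t + (\<Sum>i=1..m. bern_norm (2 * i) a * ?t ^ (2 * i - 1)))" .
    have O: "(\<Sum>i<m. bern_norm (2 * i + 1) a * y ^ (2 * i) * (1 / x ^ (2 * N * (m - i) + 1)))
        = 1 / x ^ (2 * N * m + 1) * (\<Sum>i<m. bern_norm (2 * i + 1) a * ?t ^ (2 * i))"
      unfolding sum_distrib_left by (rule sum.cong) (use odd in auto)
    show ?thesis
      unfolding E O bern_sum_split distrib_left[symmetric] right_diff_distrib[symmetric] by simp
  qed
  ultimately show ?thesis
    unfolding lam_term_def[abs_def] by (simp only: of_nat_0_less_iff zero_less_Suc)
qed

end

section \<open>Closed form of the remainder\<close>

lemma norm_hroot [simp]: "norm (hroot N j) = 1"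
  by (simp add: hroot_def)

context lambert_data
begin

abbreviation vroot :: "nat \<Rightarrow> int \<Rightarrow> complex" where
  "vroot k j \<equiv> of_real (r k) * hroot N j"

definition cos_coeff :: "nat \<Rightarrow> real" where
  "cos_coeff k = cos (2 * pi * real (Suc k) * a) / real (Suc k) ^ (2 * m + 1)"

definition sin_coeff :: "nat \<Rightarrow> real" where
  "sin_coeff k = sin (2 * pi * real (Suc k) * a) / real (Suc k) ^ (2 * m + 1)"

lemma coeff_bounds: "\<bar>cos_coeff k\<bar> \<le> 1 / real (Suc k) ^ (2 * m + 1)" "\<bar>sin_coeff k\<bar> \<le> 1 / real (Suc k) ^ (2 * m + 1)"
  unfolding cos_coeff_def sin_coeff_def by (auto simp: abs_divide intro!: divide_right_mono simp del: of_nat_Suc)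

lemma summable_cos_coeff: "summable cos_coeff"
  by (rule summable_comparison_test'[OF summable_inverse_Suc_power[of "2 * m + 1"]]) (use m coeff_bounds in auto)

text \<open>As \<open>r 0 \<le> r k\<close> and the root has positive real part, all denominators
  have norm at least \<open>d\<close>; the coefficients alone give convergence.\<close>

lemma summable_exp_terms:
  assumes j: "j \<in> {- int M..int M}"
  shows "summable (\<lambda>k. of_real (cos_coeff k) / (exp (2 * of_real pi * vroot k j) - 1))"
proof -
  define d where "d = exp (2 * pi * (r 0 * Re (hroot N j))) - 1"
  have z: "Re (hroot N j) > 0" using hroot_Re_pos[OF N j] .
  have d: "d > 0" unfolding d_def using z r[of 0] by simp
  have bound: "norm (of_real (cos_coeff k) / (exp (2 * of_real pi * vroot k j) - 1)) \<le> 1 / d * (1 / real (Suc k) ^ (2 * m + 1))" for k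
  proof -
    have "d \<le> exp (2 * pi * (r k * Re (hroot N j))) - 1"
      unfolding d_def using r_lower[of k] z by (simp add: mult_left_mono mult_right_mono)
    also have "\<dots> = norm (exp (2 * of_real pi * vroot k j)) - norm (1 :: complex)"
      by simp
    also have "\<dots> \<le> norm (exp (2 * of_real pi * vroot k j) - 1)"
      by (rule norm_triangle_ineq2)
    finally have "d \<le> norm (exp (2 * of_real pi * vroot k j) - 1)" .
    then have "\<bar>cos_coeff k\<bar> / norm (exp (2 * of_real pi * vroot k j) - 1) \<le> 1 / real (Suc k) ^ (2 * m + 1) / d"
      using d coeff_bounds(1)[of k] by (intro frac_le) auto
    then show ?thesis by (simp add: norm_divide mult.commute)
  qed
  have "summable (\<lambda>k. 1 / d * (1 / real (Suc k) ^ (2 * m + 1)))"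
    using m by (intro summable_mult summable_inverse_Suc_power) simp
  then show ?thesis
    by (rule summable_comparison_test') (rule bound)
qed

text \<open>The pairs grow at most linearly in \<open>r k\<close>, hence in the index. This costs
  one power and leaves the exponent \<open>2 * m\<close>, which is at least 2.\<close>

lemma summable_Digamma_terms:
  assumes j: "j \<in> {- int M..int M}"
  shows "summable (\<lambda>k. of_real (sin_coeff k) * (Digamma (\<i> * vroot k j) + Digamma (- \<i> * vroot k j)))"
proof -
  let ?D = "\<lambda>k. Digamma (\<i> * vroot k j) + Digamma (- \<i> * vroot k j)"
  define b where "b = (\<Sum>n. 1 / real (Suc n) ^ 2) / (2 * Re (hroot N j))"
  define B where "B = 2 * r 0 * b + 2 * norm (euler_mascheroni :: complex)"
  have z: "Re (hroot N j) > 0" using hroot_Re_pos[OF N j] .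
  have "0 \<le> (\<Sum>n. 1 / real (Suc n) ^ 2)"
    by (rule suminf_nonneg[OF summable_inverse_Suc_power]) simp_all
  then have b: "b \<ge> 0"
    unfolding b_def using z by (intro divide_nonneg_nonneg) simp_all
  have bound: "norm (of_real (sin_coeff k) * ?D k) \<le> B * (1 / real (Suc k) ^ (2 * m))" for k
  proof -
    let ?x = "real (Suc k)"
    \<comment> \<open>\<open>Digamma_pair_bound\<close> estimates \<open>g + d / 2\<close> with
      \<open>g\<close> Euler's constant; this recovers \<open>d\<close>.\<close>
    have "norm d \<le> 2 * norm (g + d / 2) + 2 * norm g" for d g :: complex
    proof -
      have "d = 2 * (g + d / 2) - 2 * g" by (simp add: distrib_left)
      then have "norm d \<le> norm (2 * (g + d / 2)) + norm (2 * g)"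
        using norm_triangle_ineq4[of "2 * (g + d / 2)" "2 * g"] by (simp only:)
      then show ?thesis by (simp only: norm_mult norm_numeral)
    qed
    then have "norm (?D k) \<le> 2 * norm (euler_mascheroni + ?D k / 2) + 2 * norm (euler_mascheroni :: complex)" .
    also have "\<dots> \<le> 2 * (r k * b) + 2 * norm (euler_mascheroni :: complex)"
      using Digamma_pair_bound[OF r z norm_hroot] unfolding b_def
      by (intro add_right_mono mult_left_mono) simp_all
    also have "\<dots> \<le> 2 * (r 0 * ?x * b) + 2 * norm (euler_mascheroni :: complex) * ?x"
    proof (intro add_mono mult_left_mono mult_right_mono r_upper b)
      have "2 * norm (euler_mascheroni :: complex) * 1 \<le> 2 * norm (euler_mascheroni :: complex) * ?x"
        by (rule mult_left_mono) auto
      then show "2 * norm (euler_mascheroni :: complex) \<le> 2 * norm (euler_mascheroni :: complex) * ?x"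
        by (simp only: mult_1_right)
    qed simp
    also have "\<dots> = B * ?x" by (simp add: B_def algebra_simps)
    finally have "norm (of_real (sin_coeff k) * ?D k) \<le> 1 / ?x ^ (2 * m + 1) * (B * ?x)"
      unfolding norm_mult using coeff_bounds(2)[of k] by (intro mult_mono) auto
    then show ?thesis by (simp add: power_add mult.commute)
  qed
  have "summable (\<lambda>k. B * (1 / real (Suc k) ^ (2 * m)))"
    using m by (intro summable_mult summable_inverse_Suc_power) simp
  then show ?thesis
    by (rule summable_comparison_test') (rule bound)
qed

text \<open>The sine prefactor is needed in two forms: through \<open>sin_coeff\<close> for the
  Digamma terms, and as a summand of the Fourier series of B_{2m+1} for Euler's constant. The last
  identity turns the correction at \<open>N = 1\<close> into a summand of the series of
  B_{2m+2}.\<close>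

lemma scaled_coeff_identities:
  fixes k :: nat
  defines "c \<equiv> 2 * pi * real (Suc k)"
  shows "(y / c) ^ (2 * m) * (2 / y * cos (c * a)) * (pi / (real N * r k ^ N))
      = y ^ (2 * m) / (real N * (2 * pi) ^ (2 * m)) * cos_coeff k"
    and "(y / c) ^ (2 * m) * (2 / c * sin (c * a)) = y ^ (2 * m) / (real N * (2 * pi) ^ (2 * m)) * (real N / pi * sin_coeff k)"
    and "(y / c) ^ (2 * m) * (2 / c * sin (c * a)) = y ^ (2 * m) * (2 * sin (c * a) / c ^ (2 * m + 1))"
    and "N = 1 \<Longrightarrow> (y / c) ^ (2 * m) * (2 / y * cos (c * a)) * (1 / (2 * r k ^ 2)) = y ^ (2 * m + 1) * (cos (c * a) / c ^ (2 * m + 2))"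
proof -
  let ?x = "real (Suc k)"
  have c: "c \<noteq> 0" "?x \<noteq> 0" "real N \<noteq> 0" using N_pos by (simp_all add: c_def)
  have ca: "2 * pi * ?x * a = c * a" by (simp add: c_def)
  have pw: "(y / c) ^ (2 * m) = y ^ (2 * m) / (2 * pi) ^ (2 * m) / ?x ^ (2 * m)"
    by (simp add: c_def power_divide power_mult_distrib del: of_nat_Suc)
  have "pi / (real N * r k ^ N) = y / (real N * (2 * ?x))"
    unfolding rN using c y by (simp del: of_nat_Suc)
  then show "(y / c) ^ (2 * m) * (2 / y * cos (c * a)) * (pi / (real N * r k ^ N))
      = y ^ (2 * m) / (real N * (2 * pi) ^ (2 * m)) * cos_coeff k"
    unfolding pw cos_coeff_def ca using y c by (simp del: of_nat_Suc)
  have "2 / c = 1 / (pi * ?x)" by (simp add: c_def del: of_nat_Suc)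
  then show "(y / c) ^ (2 * m) * (2 / c * sin (c * a)) = y ^ (2 * m) / (real N * (2 * pi) ^ (2 * m)) * (real N / pi * sin_coeff k)"
    unfolding pw sin_coeff_def ca using c by (simp del: of_nat_Suc)
  show "(y / c) ^ (2 * m) * (2 / c * sin (c * a)) = y ^ (2 * m) * (2 * sin (c * a) / c ^ (2 * m + 1))"
    by (simp add: power_divide)
  assume "N = 1"
  then have "r k = c / y" using rN[of k] by (simp add: c_def)
  then show "(y / c) ^ (2 * m) * (2 / y * cos (c * a)) * (1 / (2 * r k ^ 2)) = y ^ (2 * m + 1) * (cos (c * a) / c ^ (2 * m + 2))"
    using y c by (simp add: power_divide power2_eq_square mult_ac)
qed

text \<open>The inner sums are real series with closed forms written in complex terms; this
  transfers convergence and value.\<close>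

lemma of_real_sums_complexD:
  fixes f :: "nat \<Rightarrow> real" and z :: complex
  assumes "(\<lambda>n. of_real (f n)) sums z"
  shows "f sums suminf f" "of_real (suminf f) = z"
proof -
  have "f sums Re z" using sums_Re[OF assms] by simp
  then show *: "f sums suminf f" using sums_iff by blast
  show "of_real (suminf f) = z"
    using sums_unique2[OF sums_of_real[OF *] assms] .
qed

text \<open>For every root the series over \<open>k\<close> converges separately, so the finite root
  sum may be moved outside. Euler's constant does not depend on \<open>k\<close>, and its
  coefficients resum to B_{2m+1}(a); the correction at \<open>N = 1\<close> resums to
  B_{2m+2}(a).\<close>

lemma remainder_sum_eq:
  "complex_of_real remainder_sum =
    of_real ((-1) ^ m * y ^ (2 * m) / (real N * (2 * pi) ^ (2 * m))) *
      (of_real ((-1) ^ (m + 1) * (2 * pi) ^ (2 * m) * bern_norm (2 * m + 1) a * real N * euler_mascheroni)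
       + of_real (1 / 2 * (\<Sum>k. cos_coeff k))
       + (-1) ^ M * (\<Sum>j = - int M..int M. (-1) powi j *
           (\<Sum>k. of_real (cos_coeff k) / (exp (2 * of_real pi * vroot k j) - 1)))
       + 1 / of_real (2 * pi) * (\<Sum>j = - int M..int M.
           \<Sum>k. of_real (sin_coeff k) * (Digamma (\<i> * vroot k j) + Digamma (- \<i> * vroot k j))))
    - of_real (if N = 1 then y ^ (2 * m + 1) * bern_norm (2 * m + 2) a / 2 else 0)"
proof -
  let ?J = "{- int M..int M}"
  let ?c = "\<lambda>k. 2 * pi * real (Suc k)"
  let ?E = "\<lambda>k j. 1 / (exp (2 * of_real pi * vroot k j) - 1)"
  let ?D = "\<lambda>k j. Digamma (\<i> * vroot k j) + Digamma (- \<i> * vroot k j)"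
  define A where "A k = (\<Sum>n. real (Suc n) ^ (N - 1) / (real (Suc n) ^ (2 * N) + r k ^ (2 * N)))" for k
  define B where "B k = (\<Sum>n. 1 / real (Suc n) - real (Suc n) ^ (2 * N - 1) / (real (Suc n) ^ (2 * N) + r k ^ (2 * N)))" for k
  define F where "F = y ^ (2 * m) / (real N * (2 * pi) ^ (2 * m))"
  note sA = of_real_sums_complexD[OF sums_power_over_power_sum[OF N r]]
  note sB = of_real_sums_complexD[OF sums_Digamma_power_sum[OF N r]]
  have A: "complex_of_real (A k) = of_real (pi / (real N * r k ^ N)) * (1 / 2 + (-1) ^ M * (\<Sum>j\<in>?J. (-1) powi j * ?E k j))
      - of_real (if N = 1 then 1 / (2 * r k ^ 2) else 0)" for k
    using sA(2)[of k] by (simp only: A_def times_divide_eq_right mult_1_right)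
  have B: "complex_of_real (B k) = euler_mascheroni + 1 / (2 * of_nat N) * (\<Sum>j\<in>?J. ?D k j)" for k
    using sB(2)[of k] by (simp only: B_def)
  have "(\<lambda>k. (-1) ^ m * (y / ?c k) ^ (2 * m) *
      (2 / y * cos (?c k * a) * A k + 2 / ?c k * sin (?c k * a) * B k)) sums remainder_sum"
    by (rule remainder_swap) (simp_all only: A_def B_def sA sB)
  from sums_of_real[OF this, where 'a = complex]
  have L: "(\<lambda>k. complex_of_real ((-1) ^ m * (y / ?c k) ^ (2 * m) *
      (2 / y * cos (?c k * a) * A k + 2 / ?c k * sin (?c k * a) * B k))) sums of_real remainder_sum" .
  define T where "T k = of_real F * (of_real (1/2 * cos_coeff k)
      + (-1) ^ M * (\<Sum>j\<in>?J. (-1) powi j * (of_real (cos_coeff k) / (exp (2 * of_real pi * vroot k j) - 1)))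
      + 1 / of_real (2 * pi) * (\<Sum>j\<in>?J. of_real (sin_coeff k) * ?D k j))
      + of_real (y ^ (2 * m) * euler_mascheroni * (2 * sin (?c k * a) / ?c k ^ (2 * m + 1)))
      - of_real (if N = 1 then y ^ (2 * m + 1) * (cos (?c k * a) / ?c k ^ (2 * m + 2)) else 0)" for k
  have T: "complex_of_real ((-1) ^ m * (y / ?c k) ^ (2 * m) *
      (2 / y * cos (?c k * a) * A k + 2 / ?c k * sin (?c k * a) * B k)) = (-1) ^ m * T k" for k
  proof -
    define p where "p = (y / ?c k) ^ (2 * m) * (2 / y * cos (?c k * a))"
    define q where "q = (y / ?c k) ^ (2 * m) * (2 / ?c k * sin (?c k * a))"
    define SE where "SE = (\<Sum>j\<in>?J. (-1) powi j * ?E k j)"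
    define SD where "SD = (\<Sum>j\<in>?J. ?D k j)"
    have p1: "p * (pi / (real N * r k ^ N)) = F * cos_coeff k"
      unfolding p_def F_def by (rule scaled_coeff_identities)
    have p2: "p * (if N = 1 then 1 / (2 * r k ^ 2) else 0) = (if N = 1 then y ^ (2 * m + 1) * (cos (?c k * a) / ?c k ^ (2 * m + 2)) else 0)"
    proof (cases "N = 1")
      case True
      show ?thesis
        unfolding p_def if_P[OF True] by (rule scaled_coeff_identities(4)[OF True])
    qed simp
    have q1: "q = F * (real N / pi * sin_coeff k)"
      unfolding q_def F_def by (rule scaled_coeff_identities)
    have q2: "q = y ^ (2 * m) * (2 * sin (?c k * a) / ?c k ^ (2 * m + 1))"
      unfolding q_def by (rule scaled_coeff_identities)
    have "complex_of_real ((-1) ^ m * (y / ?c k) ^ (2 * m) *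
      (2 / y * cos (?c k * a) * A k + 2 / ?c k * sin (?c k * a) * B k))
      = (-1) ^ m * (of_real p * of_real (A k) + of_real q * of_real (B k))"
      unfolding p_def q_def by (simp add: algebra_simps del: of_nat_Suc)
    also have "of_real p * of_real (A k) = of_real F * (of_real (1 / 2 * cos_coeff k) + (-1) ^ M * (of_real (cos_coeff k) * SE))
       - of_real (if N = 1 then y ^ (2 * m + 1) * (cos (?c k * a) / ?c k ^ (2 * m + 2)) else 0)"
    proof -
      have "of_real p * of_real (A k) = of_real (p * (pi / (real N * r k ^ N))) * (1 / 2 + (-1) ^ M * SE)
        - of_real (p * (if N = 1 then 1 / (2 * r k ^ 2) else 0))"
        unfolding A SE_def[symmetric] by (simp only: right_diff_distrib of_real_mult mult.assoc)
      then show ?thesis unfolding p1 p2 by (simp add: algebra_simps)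
    qed
    also have "of_real q * of_real (B k) = of_real (y ^ (2 * m) * euler_mascheroni * (2 * sin (?c k * a) / ?c k ^ (2 * m + 1)))
       + of_real F * (1 / of_real (2 * pi) * (of_real (sin_coeff k) * SD))"
    proof -
      have "of_real q * of_real (B k) = of_real q * euler_mascheroni + of_real q * (1 / (2 * of_nat N) * SD)"
        unfolding B SD_def[symmetric] by (rule distrib_left)
      also have "of_real q * euler_mascheroni = complex_of_real (y ^ (2 * m) * euler_mascheroni * (2 * sin (?c k * a) / ?c k ^ (2 * m + 1)))"
        unfolding q2 by (simp del: of_nat_Suc)
      also have "of_real q * (1 / (2 * of_nat N) * SD) = of_real F * (1 / of_real (2 * pi) * (of_real (sin_coeff k) * SD))"
        unfolding q1 using N_pos by simp
      finally show ?thesis .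
    qed
    also have "f * (x1 + x2) - x + (u + f * x3) = f * (x1 + x2 + x3) + u - x" for f x x1 x2 x3 u :: complex
      by (simp add: algebra_simps)
    moreover have "of_real (cos_coeff k) * SE = (\<Sum>j\<in>?J. (-1) powi j * (of_real (cos_coeff k) / (exp (2 * of_real pi * vroot k j) - 1)))"
      unfolding SE_def sum_distrib_left by (intro sum.cong) simp_all
    moreover have "of_real (sin_coeff k) * SD = (\<Sum>j\<in>?J. of_real (sin_coeff k) * ?D k j)"
      unfolding SD_def by (rule sum_distrib_left)
    ultimately show ?thesis
      unfolding T_def by (simp only:)
  qed
  have "(\<lambda>k. (-1) ^ m * T k) sums ((-1) ^ m * (of_real F * (of_real (1/2 * (\<Sum>k. cos_coeff k))
      + (-1) ^ M * (\<Sum>j\<in>?J. (-1) powi j * (\<Sum>k. of_real (cos_coeff k) / (exp (2 * of_real pi * vroot k j) - 1)))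
      + 1 / of_real (2 * pi) * (\<Sum>j\<in>?J. \<Sum>k. of_real (sin_coeff k) * ?D k j))
      + of_real (y ^ (2 * m) * euler_mascheroni * ((-1) ^ (m + 1) * bern_norm (2 * m + 1) a))
      - of_real (if N = 1 then y ^ (2 * m + 1) * ((-1) ^ m * bern_norm (2 * m + 2) a / 2) else 0)))"
    unfolding T_def
  proof (intro sums_mult sums_add sums_diff sums_of_real sums_sum summable_sums summable_cos_coeff
      summable_exp_terms summable_Digamma_terms)
    have "(\<lambda>k. (-1) ^ (m + 1) * (2 * (-1) ^ (m + 1) * sin (?c k * a) / ?c k ^ (2 * m + 1))) sums
        ((-1) ^ (m + 1) * bern_norm (2 * m + 1) a)"
      by (intro sums_mult bern_norm_odd_Fourier m a)
    then show "(\<lambda>k. 2 * sin (?c k * a) / ?c k ^ (2 * m + 1)) sums ((-1) ^ (m + 1) * bern_norm (2 * m + 1) a)"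
      by (cases "even m") simp_all
    have "(\<lambda>k. (-1) ^ m / 2 * (2 * (-1) ^ (m + 1 + 1) * cos (?c k * a) / ?c k ^ (2 * (m + 1)))) sums
        ((-1) ^ m / 2 * bern_norm (2 * (m + 1)) a)"
      by (intro sums_mult bern_norm_even_Fourier a) simp
    moreover have "2 * (m + 1) = 2 * m + 2" by simp
    moreover have "(-1) ^ m / 2 * (2 * (-1) ^ (m + 1 + 1) * u / w) = u / w" for u w :: real
      by (cases "even m") simp_all
    moreover have "(-1) ^ m / 2 * w = (-1) ^ m * w / 2" for w :: real
      by simp
    ultimately have "(\<lambda>k. cos (?c k * a) / ?c k ^ (2 * m + 2)) sums ((-1) ^ m * bern_norm (2 * m + 2) a / 2)"
      by (simp only:)
    from sums_mult[OF this, of "y ^ (2 * m + 1)"]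
    show "(\<lambda>k. if N = 1 then y ^ (2 * m + 1) * (cos (?c k * a) / ?c k ^ (2 * m + 2)) else 0) sums
      (if N = 1 then y ^ (2 * m + 1) * ((-1) ^ m * bern_norm (2 * m + 2) a / 2) else 0)"
      by simp
  qed
  from sums_unique2[OF L[unfolded T] this]
  have R: "complex_of_real remainder_sum = (-1) ^ m * (of_real F * (X1 + X2 + X3)
      + of_real (y ^ (2 * m) * euler_mascheroni * ((-1) ^ (m + 1) * bern_norm (2 * m + 1) a))
      - of_real (if N = 1 then y ^ (2 * m + 1) * ((-1) ^ m * bern_norm (2 * m + 2) a / 2) else 0))"
    if "X1 = of_real (1/2 * (\<Sum>k. cos_coeff k))"
      "X2 = (-1) ^ M * (\<Sum>j\<in>?J. (-1) powi j * (\<Sum>k. of_real (cos_coeff k) / (exp (2 * of_real pi * vroot k j) - 1)))"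
      "X3 = 1 / of_real (2 * pi) * (\<Sum>j\<in>?J. \<Sum>k. of_real (sin_coeff k) * ?D k j)" for X1 X2 X3
    unfolding that .
  have G: "y ^ (2 * m) * euler_mascheroni * ((-1) ^ (m + 1) * bern_norm (2 * m + 1) a)
      = F * ((-1) ^ (m + 1) * (2 * pi) ^ (2 * m) * bern_norm (2 * m + 1) a * real N * euler_mascheroni)"
    unfolding F_def using N_pos by simp
  \<comment> \<open>The outer sign meets the sign of the cosine series, so the correction ends up
    unsigned.\<close>
  have X: "(-1) ^ m * complex_of_real (if N = 1 then y ^ (2 * m + 1) * ((-1) ^ m * bern_norm (2 * m + 2) a / 2) else 0)
      = of_real (if N = 1 then y ^ (2 * m + 1) * bern_norm (2 * m + 2) a / 2 else 0)"
    by (cases "even m") simp_all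
  have FF: "complex_of_real ((-1) ^ m * y ^ (2 * m) / (real N * (2 * pi) ^ (2 * m))) = (-1) ^ m * of_real F"
    by (simp add: F_def)
  show ?thesis
    unfolding R[OF refl refl refl] G right_diff_distrib X FF of_real_mult[of F] distrib_left[of "of_real F"] distrib_left[of "(-1) ^ m"]
    by (simp only: distrib_left mult.assoc add_ac)
qed

end

section \<open>Assembling the transformation formula\<close>

text \<open>The polynomial is monic and linear; its zero mean fixes the constant.\<close>

lemma bern_norm_1: "bern_norm 1 x = x - 1/2"
proof -
  have c0: "fps_nth (fps_X / (fps_exp 1 - 1) :: real fps) 0 = 1"
    using bern_norm_0[of 0] by (simp add: bern_norm_sum)
  define c where "c = (fps_nth (fps_X / (fps_exp 1 - 1)) 1 :: real)"
  have lin: "bern_norm 1 x = x + c" for x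
    by (simp add: bern_norm_sum c0 c_def)
  have "((\<lambda>x. x + c) has_integral ((1 ^ 2 / 2 + c * 1) - (0 ^ 2 / 2 + c * 0))) {0..1::real}"
    by (rule fundamental_theorem_of_calculus)
      (auto intro!: derivative_eq_intros simp flip: has_real_derivative_iff_has_vector_derivative)
  moreover have "((\<lambda>x. x + c) has_integral 0) {0..1::real}"
    using bern_norm_has_integral_0[of 1] by (simp only: lin[abs_def] zero_less_one)
  ultimately have "(1 ^ 2 / 2 + c * 1) - (0 ^ 2 / 2 + c * 0) = (0::real)"
    by (rule has_integral_unique)
  then have "c = - 1/2" by simp
  then show ?thesis using lin by simp
qed

lemma hroot_conv_exp: "hroot N j = exp (\<i> * complex_of_real (pi * real_of_int j / real N))"
  by (simp add: hroot_def cis_conv_exp)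

section \<open>Powers of \<alpha>, \<beta> and pi\<close>

text \<open>In logarithms the constraint is linear, so \<open>ln pi\<close> can be eliminated and
  identities between real powers become comparisons of the coefficients of
  \<open>ln \<alpha>\<close> and \<open>ln \<beta>\<close>.\<close>

lemma ln_pi_relation:
  assumes "0 < \<alpha>" "0 < \<beta>" "\<alpha> * \<beta> ^ N = pi ^ (N + 1)"
  shows "(real N + 1) * ln pi = ln \<alpha> + real N * ln \<beta>"
proof -
  have "ln \<alpha> + real N * ln \<beta> = ln (\<alpha> * \<beta> ^ N)"
    using assms(1,2) by (simp add: ln_mult ln_realpow)
  also have "\<dots> = real (N + 1) * ln pi"
    unfolding assms(3) by (rule ln_realpow)
  finally show ?thesis by simp
qed

text \<open>\<open>2 * l\<close> is the index of the Bernoulli number. It is prescribed over the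
  reals because \<open>N = 1\<close> brings in \<open>j = m + 1\<close> with \<open>l = 0\<close>,
  where the natural difference \<open>m - j\<close> would truncate. The parity assumption matches
  the sign of the even zeta value; \<open>q\<close> will be \<open>(N + 3) div 2\<close>.\<close>

lemma zeta_term_rewrite:
  fixes \<alpha> \<beta> u w :: real
  assumes pos: "0 < \<alpha>" "0 < \<beta>" and rel: "\<alpha> * \<beta> ^ N = pi ^ (N + 1)"
    and l: "real (2 * l) = real N + 1 + 2 * real N * (real m - real j)"
    and parity: "even (l + 1 + (m + q + j))"
  shows "\<alpha> powr (- (2 * real N * real m) / (real N + 1)) *
      (u * (2 ^ N * \<alpha>) ^ (2 * j) / (2 ^ N * \<alpha>) * ((-1) ^ (l + 1) * (2 * pi) ^ (2 * l) * w / 2))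
    = (-1) ^ (m + q) * 2 ^ (2 * N * m) * ((-1) ^ j * u * w * \<alpha> powr (2 * real j / (real N + 1))
      * \<beta> powr (real N + 2 * (real N)\<^sup>2 * (real m - real j) / (real N + 1)))"
proof -
  let ?W = "\<alpha> powr (- (2 * real N * real m) / (real N + 1))"
  have N1: "real N + 1 \<noteq> 0" by (simp add: add_nonneg_eq_0_iff)
  have ln_pi: "ln pi = (ln \<alpha> + real N * ln \<beta>) / (real N + 1)"
    using ln_pi_relation[OF pos rel] N1 by (simp add: field_simps)
  have P: "?W * \<alpha> ^ (2 * j) / \<alpha> * pi ^ (2 * l) = \<alpha> powr (2 * real j / (real N + 1))
      * \<beta> powr (real N + 2 * (real N)\<^sup>2 * (real m - real j) / (real N + 1))"
  proof -
    have "\<alpha> ^ (2 * j) = exp (real (2 * j) * ln \<alpha>)" "pi ^ (2 * l) = exp (real (2 * l) * ln pi)"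
      using pos by (simp_all only: exp_of_nat_mult exp_ln pi_gt_zero)
    moreover have "1 / \<alpha> = exp (- ln \<alpha>)" using pos by (simp add: exp_minus field_simps)
    ultimately have "?W * \<alpha> ^ (2 * j) / \<alpha> * pi ^ (2 * l) =
        exp (- (2 * real N * real m) / (real N + 1) * ln \<alpha> + real (2 * j) * ln \<alpha> + - ln \<alpha> + real (2 * l) * ln pi)"
      using pos unfolding powr_def exp_add by (simp add: divide_inverse)
    also have "- (2 * real N * real m) / (real N + 1) * ln \<alpha> + real (2 * j) * ln \<alpha> + - ln \<alpha> + real (2 * l) * ln pi
      = 2 * real j / (real N + 1) * ln \<alpha> + (real N + 2 * (real N)\<^sup>2 * (real m - real j) / (real N + 1)) * ln \<beta>"
      unfolding l unfolding ln_pi of_nat_mult of_nat_numeral using N1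
      by (simp add: divide_simps) (simp add: algebra_simps power2_eq_square)
    finally show ?thesis using pos by (simp add: powr_def exp_add)
  qed
  have "real (N * (2 * j) + 2 * l) = real (2 * N * m + N + 1)"
    using l by (simp add: algebra_simps)
  then have "N * (2 * j) + 2 * l = 2 * N * m + N + 1"
    by (simp only: of_nat_eq_iff)
  then have "(2::real) ^ (N * (2 * j)) * 2 ^ (2 * l) = 2 ^ (2 * N * m) * 2 ^ N * 2"
    by (simp add: power_add[symmetric])
  then have two: "(2 ^ N) ^ (2 * j) * 2 ^ (2 * l) / (2 ^ N * 2) = (2::real) ^ (2 * N * m)"
    by (simp add: power_mult)
  have sign: "(-1::real) ^ (l + 1) = (-1) ^ (m + q) * (-1) ^ j"
    using parity by (simp add: uminus_power_if)
  have "?W * (u * (2 ^ N * \<alpha>) ^ (2 * j) / (2 ^ N * \<alpha>) * ((-1) ^ (l + 1) * (2 * pi) ^ (2 * l) * w / 2))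
    = (-1) ^ (l + 1) * u * w * ((2 ^ N) ^ (2 * j) * 2 ^ (2 * l) / (2 ^ N * 2)) * (?W * \<alpha> ^ (2 * j) / \<alpha> * pi ^ (2 * l))"
    by (simp add: power_mult_distrib mult_ac)
  then show ?thesis
    unfolding P two sign by simp
qed

text \<open>Once pi is eliminated, the exponent of \<open>\<alpha>\<close> is -2Nm/(N+1) + 2m -
  2m/(N+1) = 0, so only a power of \<open>\<beta>\<close> remains.\<close>

lemma prefactor_rewrite:
  fixes \<alpha> \<beta> :: real
  assumes pos: "0 < \<alpha>" "0 < \<beta>" and rel: "\<alpha> * \<beta> ^ N = pi ^ (N + 1)" and N: "N > 0"
  shows "\<alpha> powr (- (2 * real N * real m) / (real N + 1)) *
      ((-1) ^ m * (2 ^ N * \<alpha>) ^ (2 * m) / (real N * (2 * pi) ^ (2 * m)))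
    = inverse ((- (\<beta> powr (2 * real N / (real N + 1)))) ^ m) * 2 ^ (2 * m * (N - 1)) / real N"
proof -
  let ?W = "\<alpha> powr (- (2 * real N * real m) / (real N + 1))"
  have N1: "real N + 1 \<noteq> 0" by (simp add: add_nonneg_eq_0_iff)
  have ln_pi: "ln pi = (ln \<alpha> + real N * ln \<beta>) / (real N + 1)"
    using ln_pi_relation[OF pos rel] N1 by (simp add: field_simps)
  have P: "?W * \<alpha> ^ (2 * m) / pi ^ (2 * m) = inverse ((\<beta> powr (2 * real N / (real N + 1))) ^ m)"
  proof -
    have "\<alpha> ^ (2 * m) = exp (real (2 * m) * ln \<alpha>)" "pi ^ (2 * m) = exp (real (2 * m) * ln pi)"
      using pos by (simp_all only: exp_of_nat_mult exp_ln pi_gt_zero)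
    moreover have "?W = exp (- (2 * real N * real m) / (real N + 1) * ln \<alpha>)"
      using pos by (simp only: powr_def) simp
    ultimately have "?W * \<alpha> ^ (2 * m) / pi ^ (2 * m) =
        exp (- (2 * real N * real m) / (real N + 1) * ln \<alpha> + real (2 * m) * ln \<alpha> - real (2 * m) * ln pi)"
      by (simp only: exp_add exp_diff)
    also have "- (2 * real N * real m) / (real N + 1) * ln \<alpha> + real (2 * m) * ln \<alpha> - real (2 * m) * ln pi
      = - (real m * (2 * real N / (real N + 1) * ln \<beta>))"
      unfolding ln_pi of_nat_mult of_nat_numeral using N1
      by (simp add: divide_simps) (simp add: algebra_simps)
    also have "exp \<dots> = inverse ((\<beta> powr (2 * real N / (real N + 1))) ^ m)"
      using pos by (simp add: powr_def exp_minus flip: exp_of_nat_mult)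
    finally show ?thesis .
  qed
  have "(2 ^ N) ^ (2 * m) = (2::real) ^ (2 * m * (N - 1)) * 2 ^ (2 * m)"
  proof -
    have "N * (2 * m) = 2 * m * (N - 1) + 2 * m" using N by (cases N) simp_all
    then show ?thesis by (simp only: power_mult[symmetric] power_add)
  qed
  then have two: "(2 ^ N) ^ (2 * m) / 2 ^ (2 * m) = (2::real) ^ (2 * m * (N - 1))"
    by simp
  have sign: "inverse ((- b) ^ m) = (-1) ^ m * inverse (b ^ m)" for b :: real
    by (cases "even m") simp_all
  have "?W * ((-1) ^ m * (2 ^ N * \<alpha>) ^ (2 * m) / (real N * (2 * pi) ^ (2 * m)))
      = (-1) ^ m * (?W * \<alpha> ^ (2 * m) / pi ^ (2 * m)) * ((2 ^ N) ^ (2 * m) / 2 ^ (2 * m)) / real N"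
    by (simp add: power_mult_distrib mult_ac)
  then show ?thesis
    unfolding P two sign by simp
qed

theorem theorem1p4:
  fixes a \<alpha> \<beta> :: real and N m :: nat
  assumes "0 < a" "a \<le> 1" "odd N" "0 < \<alpha>" "0 < \<beta>"
    and "\<alpha> * \<beta> ^ N = pi ^ (N + 1)" and "0 < m"
  shows "complex_of_real
     (\<alpha> powr (- (2 * real N * real m) / (real N + 1)) *
       ((a - 1/2) * zeta (real (2 * N * m + 1))
        + (\<Sum>j = 1..m - 1. bernpoly (2*j+1) a / fact (2*j+1)
             * zeta (real (2 * N * m + 1) - real (2 * j * N)) * (2 ^ N * \<alpha>) ^ (2*j))
        + (\<Sum>n. (1 / real (Suc n) ^ (2 * N * m + 1))
             * exp (- a * (2 * real (Suc n)) ^ N * \<alpha>)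
             / (1 - exp (- ((2 * real (Suc n)) ^ N * \<alpha>)))))) =
   complex_of_real (inverse ((- (\<beta> powr (2 * real N / (real N + 1)))) ^ m)
       * 2 ^ (2 * m * (N - 1)) / real N) *
     ( complex_of_real ((-1) ^ (m + 1) * (2 * pi) ^ (2 * m) * bernpoly (2*m+1) a
          * real N * euler_mascheroni / fact (2*m+1))
     + complex_of_real (1/2 * (\<Sum>n. cos (2 * pi * real (Suc n) * a) / real (Suc n) ^ (2*m+1)))
     + (-1) ^ ((N + 3) div 2) *
       (\<Sum>j = - ((int N - 1) div 2) .. (int N - 1) div 2.
          (-1) powi j *
          ( (\<Sum>n. complex_of_real (cos (2 * pi * real (Suc n) * a) / real (Suc n) ^ (2*m+1))
               / (exp (complex_of_real ((2 * real (Suc n)) powr (1 / real N) * \<beta>)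
                       * exp (\<i> * complex_of_real (pi * real_of_int j / real N))) - 1))
          + (-1) powi (j + int ((N + 3) div 2)) / complex_of_real (2 * pi) *
            (\<Sum>n. complex_of_real (sin (2 * pi * real (Suc n) * a) / real (Suc n) ^ (2*m+1))
               * ( Digamma (\<i> * complex_of_real (\<beta> / (2 * pi) * (2 * real (Suc n)) powr (1 / real N))
                             * exp (\<i> * complex_of_real (pi * real_of_int j / real N)))
                 + Digamma (- \<i> * complex_of_real (\<beta> / (2 * pi) * (2 * real (Suc n)) powr (1 / real N))
                             * exp (\<i> * complex_of_real (pi * real_of_int j / real N))))))))
   + complex_of_real
     ((-1) ^ (m + (N + 3) div 2) * 2 ^ (2 * N * m) *
      (\<Sum>j = 0..nat \<lfloor>(real N + 1) / (2 * real N) + real m\<rfloor>.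
         (-1) ^ j * bernpoly (2*j) a
         * bernoulli (nat (int N + 1 + 2 * int N * (int m - int j)))
         / (fact (2*j) * fact (nat (int N + 1 + 2 * int N * (int m - int j))))
         * \<alpha> powr (2 * real j / (real N + 1))
         * \<beta> powr (real N + 2 * (real N)^2 * (real m - real j) / (real N + 1))))"
proof -
  obtain M where N: "N = 2 * M + 1" using \<open>odd N\<close> by (rule oddE)
  have N_pos: "N > 0" using N by simp
  \<comment> \<open>This gives (2n)^N \<alpha> = n^N y. With \<open>r\<close> as defined next,
    \<open>2 * pi * r k\<close> is the scale in the exponentials of the right-hand side, and the
    constraint on \<open>\<alpha>\<close> and \<open>\<beta>\<close> gives \<open>r k\<close> the
    required N-th power.\<close>
  define y where "y = 2 ^ N * \<alpha>"
  define r where "r k = \<beta> / (2 * pi) * (2 * real (Suc k)) powr (1 / real N)" for k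
  interpret lambert_data N M m y a r
  proof
    fix k
    show "r k > 0" unfolding r_def using \<open>0 < \<beta>\<close> by (intro mult_pos_pos) auto
    have "((2 * real (Suc k)) powr (1 / real N)) ^ N = 2 * real (Suc k)"
      using N_pos by (simp add: powr_power del: of_nat_Suc)
    then have "r k ^ N = \<beta> ^ N / (2 * pi) ^ N * (2 * real (Suc k))"
      unfolding r_def power_mult_distrib power_divide by (simp only:)
    also have "\<beta> ^ N = pi ^ (N + 1) / \<alpha>"
      using assms(4,6) by (simp add: field_simps)
    also have "pi ^ (N + 1) / \<alpha> / (2 * pi) ^ N * (2 * real (Suc k)) = 2 * pi * real (Suc k) / y"
      by (simp add: y_def power_mult_distrib mult_ac del: of_nat_Suc)
    finally show "r k ^ N = 2 * pi * real (Suc k) / y" .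
  qed (use assms N in \<open>auto simp: y_def\<close>)
  let ?J = "{- int M..int M}"
  define W where "W = \<alpha> powr (- (2 * real N * real m) / (real N + 1))"
  define SE where "SE j = (\<Sum>k. of_real (cos_coeff k) / (exp (2 * of_real pi * vroot k j) - 1))" for j
  define SD where "SD j = (\<Sum>k. of_real (sin_coeff k) * (Digamma (\<i> * vroot k j) + Digamma (- \<i> * vroot k j)))" for j
  \<comment> \<open>For \<open>l > 0\<close> this is zeta(2l). At \<open>l = 0\<close> it is -1/2,
    the value of the continued zeta function at 0; the extra summand for \<open>N = 1\<close> takes
    this value.\<close>
  define Q where "Q l = (-1) ^ (l + 1) * (2 * pi) ^ (2 * l) * bern_norm (2 * l) 1 / 2" for l
  define Ev where "Ev = (\<Sum>i\<le>m. bern_norm (2 * i) a * y ^ (2 * i) / y * Q (M + 1 + N * (m - i)))"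
  define Ex where "Ex = (if N = 1 then y ^ (2 * m + 1) * bern_norm (2 * m + 2) a / 2 else 0)"
  define T where "T j = (-1) ^ j * bernpoly (2*j) a
         * bernoulli (nat (int N + 1 + 2 * int N * (int m - int j)))
         / (fact (2*j) * fact (nat (int N + 1 + 2 * int N * (int m - int j))))
         * \<alpha> powr (2 * real j / (real N + 1))
         * \<beta> powr (real N + 2 * (real N)^2 * (real m - real j) / (real N + 1))" for j
  have J: "- ((int N - 1) div 2) = - int M" "(int N - 1) div 2 = int M" "(N + 3) div 2 = M + 2"
    using N by simp_all

  have lhs: "(a - 1/2) * zeta (real (2 * N * m + 1))
        + (\<Sum>j = 1..m - 1. bernpoly (2*j+1) a / fact (2*j+1)
             * zeta (real (2 * N * m + 1) - real (2 * j * N)) * (2 ^ N * \<alpha>) ^ (2*j))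
        + (\<Sum>n. (1 / real (Suc n) ^ (2 * N * m + 1))
             * exp (- a * (2 * real (Suc n)) ^ N * \<alpha>)
             / (1 - exp (- ((2 * real (Suc n)) ^ N * \<alpha>)))) = remainder_sum + Ev"
  proof -
    have t: "(2 * real (Suc n)) ^ N * \<alpha> = real (Suc n) ^ N * y" for n
      by (simp add: y_def power_mult_distrib del: of_nat_Suc)
    have "(1 / real (Suc n) ^ (2 * N * m + 1)) * exp (- a * (2 * real (Suc n)) ^ N * \<alpha>)
             / (1 - exp (- ((2 * real (Suc n)) ^ N * \<alpha>))) = lam_term n" for n
      unfolding lam_term_def mult.assoc[of "- a"] t by simp
    moreover have "lam_term sums (remainder_sum + (\<Sum>i\<le>m. bern_norm (2 * i) a * y ^ (2 * i) / y * zeta (real (N + 1 + 2 * N * (m - i))))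
        - (\<Sum>i<m. bern_norm (2 * i + 1) a * y ^ (2 * i) * zeta (real (2 * N * (m - i) + 1))))"
    proof (rule lam_term_sums, rule remainder_swap)
      show "(\<lambda>n. real (Suc n) ^ (N - 1) / (real (Suc n) ^ (2 * N) + r k ^ (2 * N))) sums
          (\<Sum>n. real (Suc n) ^ (N - 1) / (real (Suc n) ^ (2 * N) + r k ^ (2 * N)))" for k
        using of_real_sums_complexD(1)[OF sums_power_over_power_sum[OF N r]] .
      show "(\<lambda>n. 1 / real (Suc n) - real (Suc n) ^ (2 * N - 1) / (real (Suc n) ^ (2 * N) + r k ^ (2 * N))) sums
          (\<Sum>n. 1 / real (Suc n) - real (Suc n) ^ (2 * N - 1) / (real (Suc n) ^ (2 * N) + r k ^ (2 * N)))" for k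
        using of_real_sums_complexD(1)[OF sums_Digamma_power_sum[OF N r]] .
    qed
    moreover have "(\<Sum>i\<le>m. bern_norm (2 * i) a * y ^ (2 * i) / y * zeta (real (N + 1 + 2 * N * (m - i)))) = Ev"
    proof -
      have "N + 1 + 2 * N * d = 2 * (M + 1 + N * d)" for d using N by simp
      then have "zeta (real (N + 1 + 2 * N * d)) = Q (M + 1 + N * d)" for d
        using zeta_even[of "M + 1 + N * d"] unfolding Q_def by (simp only: zero_less_one add_gr_0 simp_thms)
      then show ?thesis
        unfolding Ev_def by (simp only:)
    qed
    moreover have "(\<Sum>i<m. bern_norm (2 * i + 1) a * y ^ (2 * i) * zeta (real (2 * N * (m - i) + 1)))
       = (a - 1/2) * zeta (real (2 * N * m + 1))
        + (\<Sum>j = 1..m - 1. bernpoly (2*j+1) a / fact (2*j+1)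
             * zeta (real (2 * N * m + 1) - real (2 * j * N)) * (2 ^ N * \<alpha>) ^ (2*j))"
    proof -
      have "{..<m} = insert 0 {1..m - 1}" using \<open>0 < m\<close> by auto
      then have "(\<Sum>i<m. bern_norm (2 * i + 1) a * y ^ (2 * i) * zeta (real (2 * N * (m - i) + 1)))
        = bern_norm 1 a * zeta (real (2 * N * m + 1))
          + (\<Sum>i = 1..m - 1. bern_norm (2 * i + 1) a * y ^ (2 * i) * zeta (real (2 * N * (m - i) + 1)))"
        by simp
      also have "(\<Sum>i = 1..m - 1. bern_norm (2 * i + 1) a * y ^ (2 * i) * zeta (real (2 * N * (m - i) + 1)))
        = (\<Sum>j = 1..m - 1. bernpoly (2*j+1) a / fact (2*j+1)
             * zeta (real (2 * N * m + 1) - real (2 * j * N)) * (2 ^ N * \<alpha>) ^ (2*j))"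
      proof (rule sum.cong[OF refl])
        fix j assume "j \<in> {1..m - 1}"
        then have "j \<le> m" by auto
        then have "real (2 * N * (m - j) + 1) = real (2 * N * m + 1) - real (2 * j * N)"
          unfolding of_nat_add of_nat_mult of_nat_diff[OF \<open>j \<le> m\<close>] by (simp add: algebra_simps)
        then show "bern_norm (2 * j + 1) a * y ^ (2 * j) * zeta (real (2 * N * (m - j) + 1))
          = bernpoly (2*j+1) a / fact (2*j+1)
             * zeta (real (2 * N * m + 1) - real (2 * j * N)) * (2 ^ N * \<alpha>) ^ (2*j)"
          unfolding bern_norm_def y_def by (simp only: mult_ac)
      qed
      finally show ?thesis unfolding bern_norm_1 .
    qed
    ultimately show ?thesis by (simp add: sums_iff)
  qed

  \<comment> \<open>The quotient (N + 1) / (2N) is 1 for \<open>N = 1\<close> and below 1 for odd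
    \<open>N \<ge> 3\<close>. So the upper limit is \<open>m + 1\<close> or \<open>m\<close>, and
    the additional summand is \<open>- W * Ex\<close>, the correction present in the
    remainder.\<close>
  have last: "(\<Sum>j = 0..nat \<lfloor>(real N + 1) / (2 * real N) + real m\<rfloor>. (-1) ^ (m + (M + 2)) * 2 ^ (2 * N * m) * T j) = W * (Ev - Ex)"
  proof -
    have T: "(-1) ^ (m + (M + 2)) * 2 ^ (2 * N * m) * T j = W * (bern_norm (2 * j) a * y ^ (2 * j) / y * Q l)"
      if l: "int (2 * l) = int N + 1 + 2 * int N * (int m - int j)" and parity: "even (l + 1 + (m + (M + 2) + j))" for j l
    proof -
      have nat: "nat (int N + 1 + 2 * int N * (int m - int j)) = 2 * l"
        unfolding l[symmetric] by simp
      have "real_of_int (int (2 * l)) = real_of_int (int N + 1 + 2 * int N * (int m - int j))"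
        unfolding l ..
      then have "real (2 * l) = real N + 1 + 2 * real N * (real m - real j)" by simp
      from zeta_term_rewrite[OF assms(4-6) this parity, of "bern_norm (2 * j) a" "bern_norm (2 * l) 1"]
      show ?thesis
        unfolding T_def nat W_def Q_def y_def bern_norm_def bernoulli_def by simp
    qed
    have main: "(-1) ^ (m + (M + 2)) * 2 ^ (2 * N * m) * T j
        = W * (bern_norm (2 * j) a * y ^ (2 * j) / y * Q (M + 1 + N * (m - j)))" if "j \<le> m" for j
    proof (rule T)
      show "int (2 * (M + 1 + N * (m - j))) = int N + 1 + 2 * int N * (int m - int j)"
        unfolding of_nat_mult of_nat_add of_nat_diff[OF that] using N by (simp add: algebra_simps)
      \<comment> \<open>As \<open>N\<close> is odd and \<open>j \<le> m\<close>, the product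
        \<open>N * (m - j)\<close> has the parity of \<open>m + j\<close>.\<close>
      show "even (M + 1 + N * (m - j) + 1 + (m + (M + 2) + j))"
        using that N by simp
    qed
    have Sm: "(\<Sum>j\<le>m. (-1) ^ (m + (M + 2)) * 2 ^ (2 * N * m) * T j) = W * Ev"
      unfolding Ev_def sum_distrib_left by (rule sum.cong[OF refl], rule main) simp
    show ?thesis
    proof (cases "N = 1")
      case True
      then have M0: "M = 0" using N by simp
      have "\<lfloor>(real N + 1) / (2 * real N) + real m\<rfloor> = int (Suc m)"
        using True by simp
      then have fl: "nat \<lfloor>(real N + 1) / (2 * real N) + real m\<rfloor> = Suc m" by simp
      have "(-1) ^ (m + (M + 2)) * 2 ^ (2 * N * m) * T (Suc m) = W * (bern_norm (2 * Suc m) a * y ^ (2 * Suc m) / y * Q 0)"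
        by (rule T) (simp_all add: True M0)
      also have "\<dots> = - (W * Ex)"
        using y True by (simp add: Q_def Ex_def bern_norm_0)
      finally show ?thesis
        unfolding fl atLeast0AtMost using Sm by (simp only: sum.atMost_Suc) (simp only: distrib_left mult_minus_right diff_conv_add_uminus)
    next
      case False
      then have "N \<ge> 3" using N by simp
      then have "(real N + 1) / (2 * real N) < 1" "(real N + 1) / (2 * real N) \<ge> 0"
        by (simp_all add: divide_less_eq)
      then have "\<lfloor>(real N + 1) / (2 * real N) + real m\<rfloor> = int m"
        by (intro floor_unique) simp_all
      then have fl: "nat \<lfloor>(real N + 1) / (2 * real N) + real m\<rfloor> = m" by simp
      show ?thesis unfolding fl atLeast0AtMost Sm using False by (simp add: Ex_def)
    qed
  qed

  have sumJ: "(-1) ^ (M + 2) * (\<Sum>j\<in>?J. (-1) powi j * (SE j + (-1) powi (j + int (M + 2)) / of_real (2 * pi) * SD j))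
      = (-1) ^ M * (\<Sum>j\<in>?J. (-1) powi j * SE j) + 1 / of_real (2 * pi) * (\<Sum>j\<in>?J. SD j)"
  proof -
    have "(-1) ^ (M + 2) * ((-1) powi j * (SE j + (-1) powi (j + int (M + 2)) / of_real (2 * pi) * SD j))
        = (-1) ^ M * ((-1) powi j * SE j) + 1 / of_real (2 * pi) * SD j" for j
    proof -
      \<comment> \<open>The exponents \<open>M + 2\<close> and \<open>j\<close> each occur twice, so
        the Digamma sums lose their alternating sign.\<close>
      have "(-1 :: complex) ^ (M + 2) * (-1) powi j * (-1) powi (j + int (M + 2)) = 1"
        by (cases "even M"; cases "even j") (simp_all add: power_int_add)
      then have "(-1) ^ (M + 2) * (-1) powi j * ((-1) powi (j + int (M + 2)) / of_real (2 * pi) * SD j)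
          = 1 / of_real (2 * pi) * SD j"
        by (metis mult.assoc mult_1 times_divide_eq_right times_divide_eq_left)
      then show ?thesis by (simp add: distrib_left mult.assoc)
    qed
    then show ?thesis by (simp only: sum_distrib_left sum.distrib)
  qed

  have E: "(\<Sum>n. complex_of_real (cos (2 * pi * real (Suc n) * a) / real (Suc n) ^ (2*m+1))
               / (exp (complex_of_real ((2 * real (Suc n)) powr (1 / real N) * \<beta>)
                       * exp (\<i> * complex_of_real (pi * real_of_int j / real N))) - 1)) = SE j" for j
  proof -
    have "complex_of_real ((2 * real (Suc n)) powr (1 / real N) * \<beta>) * hroot N j = 2 * of_real pi * vroot n j" for n
      by (simp add: r_def del: of_nat_Suc)
    then show ?thesis
      unfolding SE_def cos_coeff_def hroot_conv_exp[symmetric] by (simp only:)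
  qed
  have D: "(\<Sum>n. complex_of_real (sin (2 * pi * real (Suc n) * a) / real (Suc n) ^ (2*m+1))
               * ( Digamma (\<i> * complex_of_real (\<beta> / (2 * pi) * (2 * real (Suc n)) powr (1 / real N))
                             * exp (\<i> * complex_of_real (pi * real_of_int j / real N)))
                 + Digamma (- \<i> * complex_of_real (\<beta> / (2 * pi) * (2 * real (Suc n)) powr (1 / real N))
                             * exp (\<i> * complex_of_real (pi * real_of_int j / real N))))) = SD j" for j
    unfolding SD_def sin_coeff_def hroot_conv_exp[symmetric] r_def[symmetric] by (simp only: mult.assoc)

  have G: "(-1) ^ (m + 1) * (2 * pi) ^ (2 * m) * bernpoly (2*m+1) a * real N * euler_mascheroni / fact (2*m+1)
      = (-1) ^ (m + 1) * (2 * pi) ^ (2 * m) * bern_norm (2*m+1) a * real N * (euler_mascheroni :: real)"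
    by (simp add: bern_norm_def)
  have last': "(-1) ^ (m + (M + 2)) * 2 ^ (2 * N * m) * (\<Sum>j = 0..nat \<lfloor>(real N + 1) / (2 * real N) + real m\<rfloor>. T j) = W * (Ev - Ex)"
    unfolding last[symmetric] by (rule sum_distrib_left)
  have pf: "inverse ((- (\<beta> powr (2 * real N / (real N + 1)))) ^ m) * 2 ^ (2 * m * (N - 1)) / real N
      = W * ((-1) ^ m * y ^ (2 * m) / (real N * (2 * pi) ^ (2 * m)))"
    unfolding W_def y_def by (rule prefactor_rewrite[OF assms(4-6) N_pos, symmetric])
  \<comment> \<open>Only the shape of the formula, in free variables: \<open>w\<close> is the power
    of \<open>\<alpha>\<close>, \<open>x\<close> the remainder, \<open>v\<close> the even zeta part,
    and \<open>e\<close> the correction that passes from the remainder to the last sum.\<close>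
  have ring: "of_real (w * (x + v)) = of_real (w * f) * (g + c + z) + of_real (w * (v - e))"
    if "of_real x = of_real f * (g + c + s + d) - of_real e" "z = s + d" for w x v f e :: real and g c z s d :: complex
    unfolding of_real_mult of_real_add of_real_diff that by (simp add: algebra_simps)
  show ?thesis
    unfolding E D
    unfolding lhs J T_def[symmetric] W_def[symmetric] last' pf G cos_coeff_def[symmetric]
    by (rule ring[OF remainder_sum_eq[folded SE_def SD_def Ex_def] sumJ])
qed

end
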